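(* Let $\Sigma\subseteq N_\mathbb{R}$ be a simplicial $d$-fan, $*$ an inner product on $N_\mathbb{R}$, $z\in\overline{\mathrm{Cub}}(\Sigma,* )$, and $\sigma\in\Sigma(k)$. Then \[ \mathrm{Vol}_\sigma(P_{\sigma,*}(z))=\det(G_\sigma)\sum_{f\in L(\sigma)}\prod_{j=1}^k\frac{\det(G_{\sigma(f,j),f(j)}(z))}{\det(G_{\sigma(f,j)})}. \]
   Context: $N_\mathbb{R}$ is a finite-dimensional real vector space. A fan $\Sigma\subseteq N_\mathbb{R}$ is a polyhedral fan with a chosen generator $u_\rho$ in the relative interior of each ray $\rho\in\Sigma(1)$; $\Sigma(k)$ is the set of $k$-dimensional cones, $\sigma(1)$ the rays of $\sigma$. $\Sigma$ is simplicial if the ray generators of each cone are linearly independent; a $d$-fan is a fan all of whose maximal cones have dimension $d$. Fix an inner product $*$ on $N_\mathbb{R}$ and $z\in\mathbb{R}^{\Sigma(1)}$. $P_{\sigma,*}(z)=\sigma\cap\{v\in N_\mathbb{R}: v*u_\rho\le z_\rho \text{ for all }\rho\in\sigma(1)\}$. $z$ is pseudo-cubical, $z\in\overline{\mathrm{Cub}}(\Sigma,* )$, if for every $\sigma\in\Sigma$ the set $\sigma\cap\{v: v*u_\rho=z_\rho\ \forall\rho\in\sigma(1)\}$ is nonempty. $N_\sigma=\mathrm{span}_\mathbb{Z}(u_\rho:\rho\in\sigma(1))$, $N_{\sigma,\mathbb{R}}=N_\sigma\otimes\mathbb{R}$, $M_\sigma$ is the dual lattice of $N_\sigma$ viewed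 inside $N_{\sigma,\mathbb{R}}$ via $*$, and $\mathrm{Vol}_\sigma$ is the volume on $N_{\sigma,\mathbb{R}}$ normalized so that a fundamental simplex of $M_\sigma$ has volume $1$. $L(\sigma)$ is the set of bijections $f:\{1,\dots,k\}\to\sigma(1)$; $\sigma(f,j)$ is the face of $\sigma$ with rays $\{f(i): i\le j\}$. $G_\sigma=(u_\rho*u_\eta)_{\rho,\eta\in\sigma(1)}$, and for $\rho\in\sigma(1)$, $G_{\sigma,\rho}(z)$ is obtained from $G_\sigma$ by replacing the column indexed by $\rho$ with $(z_\eta)_{\eta\in\sigma(1)}$. *)

theory Defs
  imports "HOL-Analysis.Analysis"
begin

section \<open>Fans with chosen ray generators\<close>

definition inner_product :: "('a::euclidean_space \<Rightarrow> 'a \<Rightarrow> real) \<Rightarrow> bool" where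
  "inner_product ip \<longleftrightarrow>
     bilinear ip \<and> (\<forall>v w. ip v w = ip w v) \<and> (\<forall>v. v \<noteq> 0 \<longrightarrow> ip v v > 0)"

definition polyhedral_cone :: "'a::euclidean_space set \<Rightarrow> bool" where
  "polyhedral_cone \<sigma> \<longleftrightarrow> (\<exists>S. finite S \<and> \<sigma> = convex_cone hull S)"

definition strongly_convex :: "'a::euclidean_space set \<Rightarrow> bool" where
  "strongly_convex \<sigma> \<longleftrightarrow> (\<forall>v. v \<in> \<sigma> \<and> - v \<in> \<sigma> \<longrightarrow> v = 0)"

definition cones :: "'a::euclidean_space set set \<Rightarrow> nat \<Rightarrow> 'a set set" where
  "cones \<Sigma> k = {\<sigma> \<in> \<Sigma>. dim \<sigma> = k}"

definition cone_rays :: "'a::euclidean_space set \<Rightarrow> 'a set set" where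
  "cone_rays \<sigma> = {\<rho>. \<rho> face_of \<sigma> \<and> dim \<rho> = 1}"

text \<open>The empty set is a face in the sense of \<open>face_of\<close>, but it is not a cone.\<close>

definition polyhedral_fan :: "'a::euclidean_space set set \<Rightarrow> bool" where
  "polyhedral_fan \<Sigma> \<longleftrightarrow>
     finite \<Sigma> \<and> \<Sigma> \<noteq> {} \<and>
     (\<forall>\<sigma>\<in>\<Sigma>. polyhedral_cone \<sigma> \<and> strongly_convex \<sigma>) \<and>
     (\<forall>\<sigma>\<in>\<Sigma>. \<forall>\<tau>. \<tau> face_of \<sigma> \<and> \<tau> \<noteq> {} \<longrightarrow> \<tau> \<in> \<Sigma>) \<and>
     (\<forall>\<sigma>\<in>\<Sigma>. \<forall>\<tau>\<in>\<Sigma>. (\<sigma> \<inter> \<tau>) face_of \<sigma> \<and> (\<sigma> \<inter> \<tau>) face_of \<tau>)"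

definition fan :: "'a::euclidean_space set set \<Rightarrow> ('a set \<Rightarrow> 'a) \<Rightarrow> bool" where
  "fan \<Sigma> u \<longleftrightarrow> polyhedral_fan \<Sigma> \<and> (\<forall>\<rho>\<in>cones \<Sigma> 1. u \<rho> \<in> rel_interior \<rho>)"

definition simplicial :: "'a::euclidean_space set set \<Rightarrow> ('a set \<Rightarrow> 'a) \<Rightarrow> bool" where
  "simplicial \<Sigma> u \<longleftrightarrow> (\<forall>\<sigma>\<in>\<Sigma>. independent (u ` cone_rays \<sigma>))"

definition d_fan :: "nat \<Rightarrow> 'a::euclidean_space set set \<Rightarrow> ('a set \<Rightarrow> 'a) \<Rightarrow> bool" where
  "d_fan d \<Sigma> u \<longleftrightarrow>
     fan \<Sigma> u \<and> (\<forall>\<sigma>\<in>\<Sigma>. (\<forall>\<tau>\<in>\<Sigma>. \<sigma> \<subseteq> \<tau> \<longrightarrow> \<tau> = \<sigma>) \<longrightarrow> dim \<sigma> = d)"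


section \<open>Truncated cones and pseudo-cubical values\<close>

text \<open>A vector \<open>z\<close> indexed by the rays of the fan is a function on sets of which only the
  values at the rays are ever used.\<close>

definition normal_polytope ::
  "('a::euclidean_space \<Rightarrow> 'a \<Rightarrow> real) \<Rightarrow> ('a set \<Rightarrow> 'a) \<Rightarrow> ('a set \<Rightarrow> real) \<Rightarrow> 'a set \<Rightarrow> 'a set"
  where "normal_polytope ip u z \<sigma> = \<sigma> \<inter> {v. \<forall>\<rho>\<in>cone_rays \<sigma>. ip v (u \<rho>) \<le> z \<rho>}"

definition pseudo_cubical ::
  "'a::euclidean_space set set \<Rightarrow> ('a set \<Rightarrow> 'a) \<Rightarrow> ('a \<Rightarrow> 'a \<Rightarrow> real) \<Rightarrow> ('a set \<Rightarrow> real) set"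
  where "pseudo_cubical \<Sigma> u ip =
    {z. \<forall>\<sigma>\<in>\<Sigma>. \<sigma> \<inter> {v. \<forall>\<rho>\<in>cone_rays \<sigma>. ip v (u \<rho>) = z \<rho>} \<noteq> {}}"


section \<open>The normalized volume of a cone\<close>

definition int_span :: "'a::euclidean_space set \<Rightarrow> 'a set" where
  "int_span S = {\<Sum>v\<in>T. of_int (c v) *\<^sub>R v | T (c :: 'a \<Rightarrow> int). finite T \<and> T \<subseteq> S}"

definition dual_lattice :: "('a::euclidean_space \<Rightarrow> 'a \<Rightarrow> real) \<Rightarrow> 'a set \<Rightarrow> 'a set" where
  "dual_lattice ip N = {m \<in> span N. \<forall>n\<in>N. ip m n \<in> \<int>}"

definition lattice_basis :: "'a::euclidean_space set \<Rightarrow> 'a set \<Rightarrow> bool" where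
  "lattice_basis B M \<longleftrightarrow> finite B \<and> independent B \<and> int_span B = M"

text \<open>Lebesgue measure on \<open>span B\<close>, transported along the coordinates with respect to the
  linearly independent set \<open>B\<close>.\<close>

definition coord_volume :: "'a::euclidean_space set \<Rightarrow> 'a set \<Rightarrow> real" where
  "coord_volume B A =
     measure (\<Pi>\<^sub>M b\<in>B. lborel) ((\<lambda>v. restrict (representation B v) B) ` A)"

text \<open>The volume for which a fundamental simplex of the lattice \<open>M\<close>, i.e. the convex hull of
  \<open>0\<close> and a lattice basis, has volume \<open>1\<close>.  The choice of the basis is immaterial, since any two
  are related by a unimodular matrix.\<close>

definition lattice_volume :: "'a::euclidean_space set \<Rightarrow> 'a set \<Rightarrow> real" where
  "lattice_volume M A =
     (let B = (SOME B. lattice_basis B M)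
      in coord_volume B A / coord_volume B (convex hull (insert 0 B)))"

definition cone_volume ::
  "('a::euclidean_space \<Rightarrow> 'a \<Rightarrow> real) \<Rightarrow> ('a set \<Rightarrow> 'a) \<Rightarrow> 'a set \<Rightarrow> 'a set \<Rightarrow> real" where
  "cone_volume ip u \<sigma> A = lattice_volume (dual_lattice ip (int_span (u ` cone_rays \<sigma>))) A"


section \<open>Gram determinants\<close>

text \<open>Determinant of a square matrix whose rows and columns are indexed by a finite set.\<close>

definition det_on :: "'i set \<Rightarrow> ('i \<Rightarrow> 'i \<Rightarrow> 'b::comm_ring_1) \<Rightarrow> 'b" where
  "det_on I A = (\<Sum>p | p permutes I. of_int (sign p) * (\<Prod>i\<in>I. A i (p i)))"

lemma det_on_UNIV: "det_on (UNIV :: 'n::finite set) A = det (\<chi> i j. A i j)"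
  by (simp add: det_on_def det_def)

definition gram ::
  "('a::euclidean_space \<Rightarrow> 'a \<Rightarrow> real) \<Rightarrow> ('a set \<Rightarrow> 'a) \<Rightarrow> 'a set \<Rightarrow> 'a set \<Rightarrow> real" where
  "gram ip u \<rho> \<eta> = ip (u \<rho>) (u \<eta>)"

definition gram_replace ::
  "('a::euclidean_space \<Rightarrow> 'a \<Rightarrow> real) \<Rightarrow> ('a set \<Rightarrow> 'a) \<Rightarrow> ('a set \<Rightarrow> real) \<Rightarrow> 'a set
    \<Rightarrow> 'a set \<Rightarrow> 'a set \<Rightarrow> real" where
  "gram_replace ip u z \<rho> \<eta> \<zeta> = (if \<zeta> = \<rho> then z \<eta> else gram ip u \<eta> \<zeta>)"

definition gram_det :: "('a::euclidean_space \<Rightarrow> 'a \<Rightarrow> real) \<Rightarrow> ('a set \<Rightarrow> 'a) \<Rightarrow> 'a set \<Rightarrow> real"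
  where "gram_det ip u \<sigma> = det_on (cone_rays \<sigma>) (gram ip u)"

definition gram_replace_det ::
  "('a::euclidean_space \<Rightarrow> 'a \<Rightarrow> real) \<Rightarrow> ('a set \<Rightarrow> 'a) \<Rightarrow> ('a set \<Rightarrow> real) \<Rightarrow> 'a set
    \<Rightarrow> 'a set \<Rightarrow> real" where
  "gram_replace_det ip u z \<sigma> \<rho> = det_on (cone_rays \<sigma>) (gram_replace ip u z \<rho>)"

text \<open>Orderings are taken extensional, so that each bijection is counted once.\<close>

definition ray_orderings :: "nat \<Rightarrow> 'a::euclidean_space set \<Rightarrow> (nat \<Rightarrow> 'a set) set" where
  "ray_orderings k \<sigma> = {f \<in> extensional {1..k}. bij_betw f {1..k} (cone_rays \<sigma>)}"

definition flag_face :: "'a::euclidean_space set \<Rightarrow> (nat \<Rightarrow> 'a set) \<Rightarrow> nat \<Rightarrow> 'a set" where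
  "flag_face \<sigma> f j = (THE \<tau>. \<tau> face_of \<sigma> \<and> \<tau> \<noteq> {} \<and> cone_rays \<tau> = f ` {1..j})"

end

theory Submission
  imports Defs
begin

text \<open>For a set \<open>J\<close> of rays of \<open>\<sigma>\<close> let \<open>w J\<close> be the point of the face spanned by \<open>J\<close>
  with \<open>w J * u \<rho> = z \<rho>\<close> for \<open>\<rho> \<in> J\<close>; by Cramer's rule its coordinates are the quotients of
  determinants in the formula, and they are nonnegative because \<open>z\<close> is pseudo-cubical.  The polytope of
  \<open>\<sigma>\<close> is the union, up to null sets disjoint, of the pyramids with apex \<open>w\<close> over the polytopes of
  the facets of \<open>\<sigma>\<close>: a point lies in the pyramid over the facet that the ray from the apex through it
  hits.  Let \<open>V J\<close> be the volume of the polytope of the face spanned by \<open>J\<close> in coordinates with respect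
  to the ray generators.  Fubini gives \<open>k! V J = (\<Sum>i\<in>J. w J i * (k - 1)! V (J - {i}))\<close> with
  \<open>k = card J\<close>, which unfolds to the sum over orderings.  The factor \<open>det G\<close> comes from passing to coordinates with respect to a basis of the
  dual lattice.\<close>

section \<open>Truncated orthants\<close>

text \<open>The polytope of a facet imposes only the constraints of its own rays, so a pyramid over
  it might violate the constraint of the removed ray. Excluding this is the main obstacle.
  Pseudo-cubicality of every face gives the missing inequality first for the apices
  \<open>w J\<close> and then, by induction on \<open>J\<close>, for all points of the polytope.

  A slice of a pyramid parallel to its base is a translate of the base polytope with all bounds
  multiplied by one factor. The induction therefore runs over a whole family with a scaling
  parameter \<open>s\<close>, in which volume is \<open>s ^ k\<close> times a constant; integrating
  this power yields the factor \<open>w J i / k\<close>.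

  The apex may lie on some facets, or be 0. Only rays with positive apex coordinate receive a
  pyramid, and the others contribute 0 to the recursion; for apex 0 the polytope shrinks to the
  origin.

  The factor \<open>k!\<close> disappears because the unit of volume is a lattice simplex, of
  coordinate volume \<open>1 / k!\<close>. The Gram matrix expresses the ray generators in the basis
  dual to them, which is why its determinant compares the two coordinate systems.\<close>

lemma sum_swap_symmetric:
  fixes G :: "'i \<Rightarrow> 'i \<Rightarrow> real"
  assumes "\<And>i j. i \<in> J \<Longrightarrow> j \<in> J \<Longrightarrow> G i j = G j i"
  shows "(\<Sum>i\<in>J. y i * (\<Sum>j\<in>J. G i j * x j)) = (\<Sum>i\<in>J. x i * (\<Sum>j\<in>J. G i j * y j))"
proof -
  have "(\<Sum>i\<in>J. y i * (\<Sum>j\<in>J. G i j * x j)) = (\<Sum>i\<in>J. \<Sum>j\<in>J. y i * G i j * x j)"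
    by (simp add: sum_distrib_left mult.assoc)
  also have "\<dots> = (\<Sum>j\<in>J. \<Sum>i\<in>J. y i * G i j * x j)"
    by (rule sum.swap)
  also have "\<dots> = (\<Sum>j\<in>J. x j * (\<Sum>i\<in>J. G j i * y i))"
    using assms by (auto simp: sum_distrib_left mult_ac intro!: sum.cong)
  finally show ?thesis .
qed

text \<open>Coordinate form of a single cone: \<open>I\<close> indexes its rays, \<open>G\<close> is
  the Gram matrix, and \<open>c J\<close> holds the coordinates of the apex \<open>w J\<close>. An
  apex is required for every subset of \<open>I\<close>, because the induction passes through all
  faces. Determinants enter only when \<open>c\<close> is instantiated.\<close>

locale pseudo_cubical_gram =
  fixes I :: "'i set" and G :: "'i \<Rightarrow> 'i \<Rightarrow> real" and z :: "'i \<Rightarrow> real"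
    and c :: "'i set \<Rightarrow> 'i \<Rightarrow> real"
  assumes finite_I: "finite I"
    and G_sym: "i \<in> I \<Longrightarrow> j \<in> I \<Longrightarrow> G i j = G j i"
    and G_pos: "J \<subseteq> I \<Longrightarrow> \<exists>i\<in>J. x i \<noteq> 0 \<Longrightarrow> 0 < (\<Sum>i\<in>J. x i * (\<Sum>j\<in>J. G i j * x j))"
    and c_nonneg: "J \<subseteq> I \<Longrightarrow> i \<in> J \<Longrightarrow> 0 \<le> c J i"
    and c_eq: "J \<subseteq> I \<Longrightarrow> i \<in> J \<Longrightarrow> (\<Sum>j\<in>J. G i j * c J j) = z i"
begin

text \<open>For \<open>s = 1\<close> this is the polytope of the face spanned by \<open>J\<close>,
  in coordinates with respect to the ray generators. Values outside \<open>J\<close> are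
  unrestricted, hence the later intersections with \<open>space\<close>.\<close>

definition trunc :: "'i set \<Rightarrow> real \<Rightarrow> ('i \<Rightarrow> real) set" where
  "trunc J s = {x. \<forall>i\<in>J. 0 \<le> x i \<and> (\<Sum>j\<in>J. G i j * x j) \<le> s * z i}"

text \<open>The pyramid over the facet opposite to \<open>i\<close>, with apex
  \<open>s * c J\<close>: the index \<open>i\<close> minimizes the ratio \<open>x j / c J j\<close>,
  so the ray from the apex through \<open>x\<close> leaves the orthant where coordinate
  \<open>i\<close> vanishes. Cross-multiplication admits \<open>c J j = 0\<close>.\<close>

definition piece :: "'i set \<Rightarrow> 'i \<Rightarrow> real \<Rightarrow> ('i \<Rightarrow> real) set" where
  "piece J i s = {x \<in> trunc J s. \<forall>j\<in>J. x i * c J j \<le> x j * c J i}"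

lemma finite_subset_I: "J \<subseteq> I \<Longrightarrow> finite J"
  using finite_I by (rule rev_finite_subset)

lemma z_nonneg:
  assumes "i \<in> I"
  shows "0 \<le> z i"
proof -
  have "0 < G i i"
    using G_pos[of "{i}" "\<lambda>_. 1"] assms by auto
  moreover have "z i = G i i * c {i} i" "0 \<le> c {i} i"
    using c_nonneg[of "{i}" i] c_eq[of "{i}" i] assms by auto
  ultimately show ?thesis by simp
qed

lemma quadratic_nonneg:
  assumes "J \<subseteq> I"
  shows "0 \<le> (\<Sum>i\<in>J. x i * (\<Sum>j\<in>J. G i j * x j))"
  using G_pos[OF assms, of x] by (cases "\<exists>i\<in>J. x i \<noteq> 0") (auto simp: less_imp_le)

text \<open>Estimate the pairing of \<open>x\<close> with the apex twice. It is at least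
  \<open>t * Q\<close> because \<open>z\<close> is nonnegative, and at most \<open>s * Q\<close>
  because the apex coordinates are nonnegative, where \<open>Q > 0\<close> is the squared norm of
  the apex. The conclusion keeps the parameter \<open>s - t\<close> of a slice nonnegative.\<close>

lemma trunc_parameter_bound:
  assumes J: "J \<subseteq> I" and x: "x \<in> trunc J s" and t: "\<And>i. i \<in> J \<Longrightarrow> t * c J i \<le> x i"
    and pos: "\<exists>i\<in>J. c J i \<noteq> 0"
  shows "t \<le> s"
proof -
  define Q where "Q = (\<Sum>i\<in>J. c J i * z i)"
  have "Q = (\<Sum>i\<in>J. c J i * (\<Sum>j\<in>J. G i j * c J j))"
    unfolding Q_def using c_eq[OF J] by (intro sum.cong) auto
  then have Q: "Q > 0" using G_pos[OF J pos] by simp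
  have "t * Q = (\<Sum>i\<in>J. (t * c J i) * z i)"
    by (simp add: Q_def sum_distrib_left mult.assoc)
  also have "\<dots> \<le> (\<Sum>i\<in>J. x i * z i)"
    using t z_nonneg J by (intro sum_mono mult_right_mono) auto
  also have "\<dots> = (\<Sum>i\<in>J. x i * (\<Sum>j\<in>J. G i j * c J j))"
    using c_eq[OF J] by (intro sum.cong) auto
  also have "\<dots> = (\<Sum>i\<in>J. c J i * (\<Sum>j\<in>J. G i j * x j))"
    using J by (intro sum_swap_symmetric G_sym) auto
  also have "\<dots> \<le> (\<Sum>i\<in>J. c J i * (s * z i))"
    using x c_nonneg[OF J] by (intro sum_mono mult_left_mono) (auto simp: trunc_def)
  also have "\<dots> = s * Q"
    by (simp add: Q_def sum_distrib_left mult_ac)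
  finally show ?thesis using Q by simp
qed

text \<open>A zero apex forces \<open>z\<close> to vanish on \<open>J\<close>, so the squared norm
  of the point with coordinates \<open>x\<close> is at most 0.\<close>

lemma trunc_eq_0:
  assumes J: "J \<subseteq> I" and x: "x \<in> trunc J s" and c0: "\<forall>i\<in>J. c J i = 0" and i: "i \<in> J"
  shows "x i = 0"
proof (rule ccontr)
  assume "x i \<noteq> 0"
  then have "0 < (\<Sum>i\<in>J. x i * (\<Sum>j\<in>J. G i j * x j))"
    using i by (intro G_pos[OF J]) auto
  also have "\<dots> \<le> (\<Sum>i\<in>J. x i * (s * z i))"
    using x by (intro sum_mono mult_left_mono) (auto simp: trunc_def)
  also have "\<dots> = 0"
    using c_eq[OF J] c0 by (intro sum.neutral) auto
  finally show False by simp
qed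

text \<open>Coordinate \<open>i\<close> of \<open>x - t * c J\<close> is 0, so its term can be put
  back into the sum, and \<open>G\<close> maps \<open>c J\<close> to \<open>z\<close>.\<close>

lemma sum_shift:
  assumes J: "J \<subseteq> I" and i: "i \<in> J" and t: "x i = t * c J i" and l: "l \<in> J"
  shows "(\<Sum>j\<in>J - {i}. G l j * (x j - t * c J j)) = (\<Sum>j\<in>J. G l j * x j) - t * z l"
proof -
  have "(\<Sum>j\<in>J - {i}. G l j * (x j - t * c J j)) = (\<Sum>j\<in>J. G l j * (x j - t * c J j))"
    using i t finite_subset_I[OF J] by (subst sum.remove[of J i]) auto
  also have "\<dots> = (\<Sum>j\<in>J. G l j * x j) - t * (\<Sum>j\<in>J. G l j * c J j)"
    by (simp add: sum_subtractf right_diff_distrib sum_distrib_left mult_ac)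
  finally show ?thesis using c_eq[OF J l] by simp
qed

text \<open>Moving a point of a pyramid by \<open>- t * c J\<close> puts it on the facet opposite to
  \<open>i\<close>; each bound drops by \<open>t * z l\<close>. This is the easy half of
  \<open>piece_slice\<close>.\<close>

lemma trunc_shift:
  assumes J: "J \<subseteq> I" and x: "x \<in> trunc J s" and i: "i \<in> J" and t: "x i = t * c J i"
    and le: "\<And>j. j \<in> J \<Longrightarrow> t * c J j \<le> x j"
  shows "(\<lambda>j. x j - t * c J j) \<in> trunc (J - {i}) (s - t)"
  using x le sum_shift[where x = x, OF J i t] by (auto simp: trunc_def left_diff_distrib)

text \<open>Only indices with positive apex coordinate compete for the minimum. At an index with
  \<open>c J j = 0\<close> the inequality just says that \<open>x j * c J i\<close> is
  nonnegative.\<close>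

lemma exists_min_ratio:
  assumes J: "J \<subseteq> I" and x: "\<And>i. i \<in> J \<Longrightarrow> 0 \<le> x i" and pos: "\<exists>i\<in>J. c J i \<noteq> 0"
  obtains i where "i \<in> J" "0 < c J i" "\<And>j. j \<in> J \<Longrightarrow> x i * c J j \<le> x j * c J i"
proof -
  define K where "K = {i \<in> J. 0 < c J i}"
  have K: "finite K" "K \<noteq> {}"
    using pos c_nonneg[OF J] finite_subset_I[OF J] by (force simp: K_def)+
  then obtain i where i: "i \<in> K" "\<And>j. j \<in> K \<Longrightarrow> x i / c J i \<le> x j / c J j"
    using ex_min_if_finite[of "(\<lambda>i. x i / c J i) ` K"] by (auto simp: not_less)
  show ?thesis
  proof (rule that[of i])
    fix j assume j: "j \<in> J"
    show "x i * c J j \<le> x j * c J i"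
    proof (cases "c J j = 0")
      case True
      then show ?thesis using x[OF j] i(1) by (auto simp: K_def)
    next
      case False
      then have "j \<in> K" using j c_nonneg[OF J j] by (auto simp: K_def)
      then show ?thesis using i(1) i(2)[of j] by (auto simp: K_def field_simps)
    qed
  qed (use i in \<open>auto simp: K_def\<close>)
qed

text \<open>Both points \<open>c K\<close> and \<open>c J\<close> solve the equations indexed by \<open>J\<close>, so
  their difference is orthogonal to the generators in \<open>J\<close> and its squared norm is the product of
  its coordinate at \<open>i\<close> with its pairing with the generator \<open>i\<close>.\<close>

lemma apex_satisfies_constraint:
  assumes J: "J \<subseteq> I" and i: "i \<in> I - J"
  shows "(\<Sum>j\<in>J. G i j * c J j) \<le> z i"
proof -
  define K where "K = insert i J"
  define d where "d = (\<lambda>j. c K j - (if j \<in> J then c J j else 0))"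
  have K: "K \<subseteq> I" "i \<in> K" using J i by (auto simp: K_def)
  have fin: "finite J" "finite K" using finite_subset_I J K by auto
  have Gd: "(\<Sum>j\<in>K. G l j * d j) = z l - (\<Sum>j\<in>J. G l j * c J j)" if "l \<in> K" for l
  proof -
    have "(\<Sum>j\<in>K. G l j * d j) = (\<Sum>j\<in>K. G l j * c K j) - (\<Sum>j\<in>K. if j \<in> J then G l j * c J j else 0)"
      unfolding d_def sum_subtractf[symmetric] by (intro sum.cong) (auto simp: algebra_simps)
    also have "(\<Sum>j\<in>K. if j \<in> J then G l j * c J j else 0) = (\<Sum>j\<in>J. G l j * c J j)"
      using fin by (simp add: sum.inter_restrict[symmetric] K_def Int_absorb1 subset_insertI)
    finally show ?thesis using c_eq[OF K(1) that] by simp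
  qed
  have d0: "(\<Sum>j\<in>K. G l j * d j) = 0" if "l \<in> J" for l
    using that Gd[of l] c_eq[OF J that] by (simp add: K_def)
  have "(\<Sum>l\<in>K. d l * (\<Sum>j\<in>K. G l j * d j)) = d i * (\<Sum>j\<in>K. G i j * d j)"
    using i fin d0 by (subst K_def, subst sum.insert) auto
  also have "d i = c K i" using i by (simp add: d_def)
  finally have eq: "(\<Sum>l\<in>K. d l * (\<Sum>j\<in>K. G l j * d j)) = c K i * (\<Sum>j\<in>K. G i j * d j)" .
  have "0 \<le> (\<Sum>j\<in>K. G i j * d j)"
  \<comment> \<open>If \<open>c K i = 0\<close>, the squared norm of \<open>d\<close> is 0, so
    \<open>d\<close> vanishes on \<open>K\<close>. Otherwise a nonnegative squared norm is divided
    by a positive factor.\<close>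
  proof (cases "c K i = 0")
    case True
    then have "\<forall>l\<in>K. d l = 0" using eq G_pos[OF K(1), of d] by auto
    then show ?thesis by simp
  next
    case False
    then show ?thesis
      using c_nonneg[OF K] eq quadratic_nonneg[OF K(1), of d] by (simp add: zero_le_mult_iff)
  qed
  then show ?thesis using Gd[OF K(2)] by simp
qed

text \<open>Split \<open>x\<close> into \<open>t * c J\<close> and a point of a facet polytope with
  parameter \<open>s - t\<close>. The first part pairs with generator \<open>i\<close> to at most
  \<open>t * z i\<close> by \<open>apex_satisfies_constraint\<close>, the second to at most
  \<open>(s - t) * z i\<close> by induction. This is what places the pyramid over a facet inside the
  polytope.\<close>

lemma trunc_satisfies_constraint:
  assumes "J \<subseteq> I" "i \<in> I - J" "0 \<le> s" "x \<in> trunc J s"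
  shows "(\<Sum>j\<in>J. G i j * x j) \<le> s * z i"
  using finite_subset_I[OF assms(1)] assms
proof (induction J arbitrary: s x rule: finite_psubset_induct)
  case (psubset J)
  note J = psubset.prems(1) and x = psubset.prems(4)
  show ?case
  proof (cases "\<exists>i\<in>J. c J i \<noteq> 0")
    case False
    then have "(\<Sum>j\<in>J. G i j * x j) = 0"
      using trunc_eq_0[OF J x] by (intro sum.neutral) auto
    then show ?thesis using psubset.prems z_nonneg by simp
  next
    case True
    have x0: "0 \<le> x j" if "j \<in> J" for j using x that by (auto simp: trunc_def)
    obtain k where k: "k \<in> J" "0 < c J k" "\<And>j. j \<in> J \<Longrightarrow> x k * c J j \<le> x j * c J k"
      using exists_min_ratio[of J x] J x0 True by metis
    define t where "t = x k / c J k"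
    have t: "x k = t * c J k" "\<And>j. j \<in> J \<Longrightarrow> t * c J j \<le> x j" "0 \<le> t"
      using k x0 by (auto simp: t_def field_simps)
    have ts: "t \<le> s" using trunc_parameter_bound[OF J x t(2) True] by simp
    have "(\<Sum>j\<in>J - {k}. G i j * (x j - t * c J j)) \<le> (s - t) * z i"
      using k psubset.prems ts trunc_shift[OF J x k(1) t(1,2)] by (intro psubset.IH) auto
    moreover have "(\<Sum>j\<in>J - {k}. G i j * (x j - t * c J j)) =
        (\<Sum>j\<in>J. G i j * x j) - t * (\<Sum>j\<in>J. G i j * c J j)"
    proof -
      have "(\<Sum>j\<in>J - {k}. G i j * (x j - t * c J j)) = (\<Sum>j\<in>J. G i j * (x j - t * c J j))"
        using k(1) t(1) finite_subset_I[OF J] by (subst sum.remove[of J k]) auto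
      also have "\<dots> = (\<Sum>j\<in>J. G i j * x j) - t * (\<Sum>j\<in>J. G i j * c J j)"
        by (simp add: sum_subtractf right_diff_distrib sum_distrib_left mult_ac)
      finally show ?thesis .
    qed
    moreover have "t * (\<Sum>j\<in>J. G i j * c J j) \<le> t * z i"
      using apex_satisfies_constraint[OF J psubset.prems(2)] t(3) by (intro mult_left_mono)
    ultimately show ?thesis by (simp add: left_diff_distrib)
  qed
qed

text \<open>With \<open>t = y / c (insert i J) i\<close>, the slice at height \<open>y\<close> is
  the facet polytope with parameter \<open>s - t\<close>, translated by \<open>t\<close> times the
  apex. This prepares the integration over coordinate \<open>i\<close>.\<close>

lemma piece_slice:
  assumes K: "insert i J \<subseteq> I" and i: "i \<notin> J" and ci: "0 < c (insert i J) i"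
  shows "x(i := y) \<in> piece (insert i J) i s \<longleftrightarrow>
    y \<in> {0..s * c (insert i J) i} \<and>
    (\<lambda>j. x j - y / c (insert i J) i * c (insert i J) j) \<in> trunc J (s - y / c (insert i J) i)"
    (is "?L \<longleftrightarrow> ?R1 \<and> ?R2")
proof -
  define K where "K = insert i J"
  define t where "t = y / c K i"
  define x' where "x' = x(i := y)"
  have K1: "K \<subseteq> I" "i \<in> K" "K - {i} = J" "J \<subseteq> I" "i \<in> I - J"
    using K i by (auto simp: K_def)
  have t: "x' i = t * c K i" using ci by (simp add: x'_def t_def K_def)
  have cong: "(\<lambda>j. x' j - t * c K j) \<in> trunc J r \<longleftrightarrow> (\<lambda>j. x j - t * c K j) \<in> trunc J r" for r
  proof -
    have "(\<Sum>j\<in>J. G l j * (x' j - t * c K j)) = (\<Sum>j\<in>J. G l j * (x j - t * c K j))" for l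
      using i by (intro sum.cong) (auto simp: x'_def)
    then show ?thesis using i by (auto simp: trunc_def x'_def)
  qed
  have ys: "y \<in> {0..s * c K i} \<longleftrightarrow> 0 \<le> t \<and> t \<le> s"
    using ci by (auto simp: t_def K_def field_simps)
  have yt: "y = t * c K i" using ci by (simp add: t_def K_def)
  have ratio: "x' i * c K j \<le> x' j * c K i \<longleftrightarrow> t * c K j \<le> x' j" for j
    using ci unfolding t K_def[symmetric] by (simp add: mult.commute mult.left_commute)
  have ?L if r1: "0 \<le> t" "t \<le> s" and r2: "(\<lambda>j. x j - t * c K j) \<in> trunc J (s - t)"
  proof -
    have r2': "(\<lambda>j. x' j - t * c K j) \<in> trunc J (s - t)" using r2 cong by simp
    have le: "t * c K j \<le> x' j" if "j \<in> K" for j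
      using r2' t that K1(3) by (cases "j = i") (auto simp: trunc_def)
    \<comment> \<open>For \<open>l = i\<close> the bound is not part of membership in
      \<open>trunc J\<close>; here the inequality for the removed ray is needed.\<close>
    have "(\<Sum>j\<in>J. G l j * (x' j - t * c K j)) \<le> (s - t) * z l" if "l \<in> K" for l
      using r2' r1 K1 that trunc_satisfies_constraint[OF K1(4,5) _ r2']
      by (cases "l = i") (auto simp: trunc_def K_def)
    then have "(\<Sum>j\<in>K. G l j * x' j) \<le> s * z l" if "l \<in> K" for l
      using sum_shift[where x = x', OF K1(1,2) t that] that
      by (fastforce simp: K1(3) left_diff_distrib)
    moreover have "0 \<le> x' j" if "j \<in> K" for j
      using le[OF that] r1(1) c_nonneg[OF K1(1) that] by (meson mult_nonneg_nonneg order_trans)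
    ultimately have "x' \<in> piece K i s"
      using le ratio by (auto simp: piece_def trunc_def)
    then show ?thesis by (simp add: x'_def K_def)
  qed
  moreover have "0 \<le> t" "t \<le> s" "(\<lambda>j. x j - t * c K j) \<in> trunc J (s - t)" if ?L
  proof -
    have x': "x' \<in> trunc K s" and le: "\<And>j. j \<in> K \<Longrightarrow> t * c K j \<le> x' j"
      using that ratio t by (auto simp: piece_def x'_def K_def)
    have "0 \<le> y" using x' K1(2) by (auto simp: trunc_def x'_def)
    then show "0 \<le> t" using ci by (simp add: t_def K_def)
    show "t \<le> s" using trunc_parameter_bound[OF K1(1) x' le] ci by (auto simp: K_def)
    show "(\<lambda>j. x j - t * c K j) \<in> trunc J (s - t)"
      using trunc_shift[OF K1(1) x' K1(2) t le] K1(3) cong by simp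
  qed
  ultimately show ?thesis
    using ys by (auto simp: t_def K_def)
qed

lemma trunc_eq_pieces:
  assumes "J \<subseteq> I" "\<exists>i\<in>J. c J i \<noteq> 0"
  shows "trunc J s = (\<Union>i\<in>{i \<in> J. 0 < c J i}. piece J i s)"
proof -
  have "x \<in> (\<Union>i\<in>{i \<in> J. 0 < c J i}. piece J i s)" if x: "x \<in> trunc J s" for x
  proof -
    have "0 \<le> x i" if "i \<in> J" for i using x that by (auto simp: trunc_def)
    then obtain i where "i \<in> J" "0 < c J i" "\<And>j. j \<in> J \<Longrightarrow> x i * c J j \<le> x j * c J i"
      using exists_min_ratio[of J x] assms by metis
    with x show ?thesis by (auto simp: piece_def)
  qed
  then show ?thesis by (auto simp: piece_def)
qed

end

section \<open>Orderings\<close>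

definition orderings :: "'i set \<Rightarrow> (nat \<Rightarrow> 'i) set" where
  "orderings J = {f \<in> extensional {1..card J}. bij_betw f {1..card J} J}"

text \<open>With the quotients of determinants as \<open>c\<close> this is the sum in the theorem.
  It will turn out to be \<open>fact (card J)\<close> times the volume of
  \<open>trunc J 1\<close>.\<close>

definition ordering_sum :: "('i set \<Rightarrow> 'i \<Rightarrow> real) \<Rightarrow> 'i set \<Rightarrow> real" where
  "ordering_sum c J = (\<Sum>f\<in>orderings J. \<Prod>j=1..card J. c (f ` {1..j}) (f j))"

lemma finite_orderings:
  assumes "finite J"
  shows "finite (orderings J)"
proof (rule finite_subset)
  show "orderings J \<subseteq> {1..card J} \<rightarrow>\<^sub>E J"
    by (auto simp: orderings_def PiE_def bij_betw_def)
  show "finite ({1..card J} \<rightarrow>\<^sub>E J)"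
    using assms by (intro finite_PiE) auto
qed

lemma ordering_sum_empty [simp]: "ordering_sum c {} = 1"
proof -
  have "orderings ({} :: 'a set) = {\<lambda>_. undefined}"
    by (auto simp: orderings_def bij_betw_def)
  then show ?thesis by (simp add: ordering_sum_def)
qed

text \<open>Split off the last entry \<open>i\<close> of an ordering. Its factor is
  \<open>c J i\<close>, since the full image is \<open>J\<close>, and what precedes it is an
  arbitrary ordering of \<open>J - {i}\<close>. The volume satisfies the same recursion.\<close>

lemma ordering_sum_rec:
  assumes J: "finite J" "J \<noteq> {}"
  shows "ordering_sum c J = (\<Sum>i\<in>J. c J i * ordering_sum c (J - {i}))"
proof -
  define n where "n = card (J) - 1"
  have n: "card J = Suc n" using J by (simp add: n_def card_gt_0_iff Suc_leI)
  have ni: "card (J - {i}) = n" if "i \<in> J" for i using that n by simp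
  define X where "X = (SIGMA i:J. orderings (J - {i}))"
  have fun_upd_ord: "g(Suc n := i) \<in> orderings J" if "i \<in> J" "g \<in> orderings (J - {i})" for i g
  proof -
    have g: "bij_betw g {1..n} (J - {i})" "g \<in> extensional {1..n}"
      using that ni by (auto simp: orderings_def)
    have "bij_betw (g(Suc n := i)) ({1..n} \<union> {Suc n}) ((J - {i}) \<union> {i})"
    proof (rule bij_betw_combine)
      show "bij_betw (g(Suc n := i)) {1..n} (J - {i})"
        using g(1) by (subst bij_betw_cong[of _ _ g]) auto
    qed (auto simp: bij_betw_def)
    moreover have "{1..n} \<union> {Suc n} = {1..Suc n}" "(J - {i}) \<union> {i} = J" using that by auto
    ultimately show ?thesis using g(2) n by (auto simp: orderings_def extensional_def)
  qed
  have restrict_ord: "f (Suc n) \<in> J" "restrict f {1..n} \<in> orderings (J - {f (Suc n)})"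
    if "f \<in> orderings J" for f
  proof -
    have f: "bij_betw f {1..Suc n} J" using that n by (auto simp: orderings_def)
    show fn: "f (Suc n) \<in> J" using bij_betwE[OF f] by simp
    have "bij_betw f ({1..Suc n} - {Suc n}) (J - {f (Suc n)})"
      using f fn by (intro bij_betw_DiffI) auto
    moreover have "{1..Suc n} - {Suc n} = {1..n}" by auto
    ultimately have "bij_betw f {1..n} (J - {f (Suc n)})" by simp
    then have "bij_betw (restrict f {1..n}) {1..n} (J - {f (Suc n)})"
      by (subst bij_betw_cong[of _ _ f]) auto
    then show "restrict f {1..n} \<in> orderings (J - {f (Suc n)})"
      using ni[OF fn] by (auto simp: orderings_def)
  qed
  have "ordering_sum c J = (\<Sum>(i,g)\<in>X. c J i * (\<Prod>j=1..n. c (g ` {1..j}) (g j)))"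
    unfolding ordering_sum_def
  proof (rule sum.reindex_bij_witness[where i = "\<lambda>(i, g). g(Suc n := i)" and
        j = "\<lambda>f. (f (Suc n), restrict f {1..n})"], goal_cases)
    case (1 f)
    then show ?case using n by (auto simp: orderings_def extensional_def fun_eq_iff)
  next
    case (2 f)
    then show ?case using restrict_ord by (auto simp: X_def)
  next
    case (3 ig)
    then show ?case using ni by (auto simp: X_def orderings_def extensional_def fun_eq_iff)
  next
    case (4 ig)
    then show ?case using fun_upd_ord by (auto simp: X_def)
  next
    case (5 f)
    have im: "f ` {1..Suc n} = J" using 5 n by (auto simp: orderings_def bij_betw_def)
    have "(\<Prod>j=1..n. c (restrict f {1..n} ` {1..j}) (restrict f {1..n} j)) =
        (\<Prod>j=1..n. c (f ` {1..j}) (f j))"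
    proof (rule prod.cong)
      fix j assume "j \<in> {1..n}"
      moreover from this have "restrict f {1..n} ` {1..j} = f ` {1..j}"
        by (intro image_cong) auto
      ultimately show "c (restrict f {1..n} ` {1..j}) (restrict f {1..n} j) = c (f ` {1..j}) (f j)"
        by simp
    qed simp
    then show ?case using im by (simp add: n mult.commute)
  qed
  also have "\<dots> = (\<Sum>i\<in>J. \<Sum>g\<in>orderings (J - {i}). c J i * (\<Prod>j=1..n. c (g ` {1..j}) (g j)))"
    unfolding X_def using J finite_orderings by (subst sum.Sigma) auto
  also have "\<dots> = (\<Sum>i\<in>J. c J i * ordering_sum c (J - {i}))"
    using ni by (intro sum.cong) (auto simp: ordering_sum_def sum_distrib_left)
  finally show ?thesis .
qed

section \<open>Lebesgue measure in coordinates\<close>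

abbreviation coord_lborel :: "'i set \<Rightarrow> ('i \<Rightarrow> real) measure" where
  "coord_lborel J \<equiv> Pi\<^sub>M J (\<lambda>_. lborel)"

interpretation lborel_product: product_sigma_finite "\<lambda>_. lborel :: real measure"
  by standard

lemma distr_coord_lborel_translation:
  assumes J: "finite J"
  shows "distr (coord_lborel J) (coord_lborel J) (\<lambda>x. \<lambda>j\<in>J. x j + a j) = coord_lborel J"
proof (rule lborel_product.PiM_eqI)
  fix A :: "'a \<Rightarrow> real set" assume A: "\<And>i. i \<in> J \<Longrightarrow> A i \<in> sets lborel"
  have "(\<lambda>x. \<lambda>j\<in>J. x j + a j) -` (Pi\<^sub>E J A) \<inter> space (coord_lborel J) =
      Pi\<^sub>E J (\<lambda>j. (\<lambda>y. y + a j) -` A j)"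
    by (auto simp: space_PiM PiE_def extensional_def Pi_def)
  moreover have vi: "(\<lambda>y. y + a j) -` A j \<in> sets lborel" if "j \<in> J" for j
    using measurable_sets[of "\<lambda>y. y + a j" borel borel "A j"] A[OF that] by auto
  moreover have "emeasure lborel ((\<lambda>y. y + a j) -` A j) = emeasure lborel (A j)" if "j \<in> J" for j
  proof -
    have "emeasure lborel (A j) = emeasure (distr lborel borel ((+) (a j))) (A j)"
      by (simp add: lborel_distr_plus)
    also have "\<dots> = emeasure lborel ((\<lambda>y. y + a j) -` A j)"
      using A[OF that] by (subst emeasure_distr) (auto simp: vimage_def add.commute)
    finally show ?thesis by simp
  qed
  ultimately show "emeasure (distr (coord_lborel J) (coord_lborel J) (\<lambda>x. \<lambda>j\<in>J. x j + a j)) (Pi\<^sub>E J A) =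
      (\<Prod>i\<in>J. emeasure lborel (A i))"
    using A J by (subst emeasure_distr)
      (auto simp: lborel_product.emeasure_PiM intro!: sets_PiM_I_finite measurable_restrict)
qed (use J in auto)

text \<open>By Fubini: \<open>hi\<close> makes \<open>h\<close> independent of coordinate
  \<open>i\<close>, so every line in that direction meets the set in at most one point.\<close>

lemma null_sets_coord_graph:
  assumes K: "finite K" "i \<in> K" and h: "h \<in> borel_measurable (coord_lborel K)"
    and hi: "\<And>x y. h (x(i := y)) = h x"
  shows "{x \<in> space (coord_lborel K). x i = h x} \<in> null_sets (coord_lborel K)"
proof -
  define J where "J = K - {i}"
  have KJ: "K = insert i J" "i \<notin> J" "finite J" using K by (auto simp: J_def)
  let ?S = "{x \<in> space (coord_lborel K). x i = h x}"
  have S: "?S \<in> sets (coord_lborel K)"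
    using h K by measurable
  have "emeasure (coord_lborel K) ?S = (\<integral>\<^sup>+ x. indicator ?S x \<partial>coord_lborel (insert i J))"
    using S by (simp add: KJ(1))
  also have "\<dots> = (\<integral>\<^sup>+ x. \<integral>\<^sup>+ y. indicator ?S (x(i := y)) \<partial>lborel \<partial>coord_lborel J)"
    using S KJ by (intro lborel_product.product_nn_integral_insert) auto
  also have "\<dots> = (\<integral>\<^sup>+ x. 0 \<partial>coord_lborel J)"
  proof (intro nn_integral_cong)
    fix x assume "x \<in> space (coord_lborel J)"
    have "(\<integral>\<^sup>+ y. indicator ?S (x(i := y)) \<partial>lborel) \<le> (\<integral>\<^sup>+ y. indicator {h x} y \<partial>lborel)"
      by (intro nn_integral_mono) (auto simp: indicator_def hi)
    then show "(\<integral>\<^sup>+ y. indicator ?S (x(i := y)) \<partial>lborel) = 0" by simp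
  qed
  finally show ?thesis using S by (auto simp: null_sets_def)
qed

section \<open>Volumes of truncated orthants\<close>

context pseudo_cubical_gram
begin

lemma sets_trunc [measurable]:
  assumes "J \<subseteq> I"
  shows "trunc J s \<inter> space (coord_lborel J) \<in> sets (coord_lborel J)"
proof -
  have fin: "finite J" using finite_subset_I[OF assms] .
  have "trunc J s \<inter> space (coord_lborel J) =
      {x \<in> space (coord_lborel J). \<forall>i\<in>J. 0 \<le> x i \<and> (\<Sum>j\<in>J. G i j * x j) \<le> s * z i}"
    by (auto simp: trunc_def)
  also have "\<dots> \<in> sets (coord_lborel J)"
    using fin by measurable
  finally show ?thesis .
qed

lemma sets_piece [measurable]:
  assumes "J \<subseteq> I" "i \<in> J"
  shows "piece J i s \<inter> space (coord_lborel J) \<in> sets (coord_lborel J)"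
proof -
  have fin: "finite J" using finite_subset_I[OF assms(1)] .
  have "piece J i s \<inter> space (coord_lborel J) = (trunc J s \<inter> space (coord_lborel J)) \<inter>
      {x \<in> space (coord_lborel J). \<forall>j\<in>J. x i * c J j \<le> x j * c J i}"
    by (auto simp: piece_def)
  also have "\<dots> \<in> sets (coord_lborel J)"
  proof (rule sets.Int[OF sets_trunc[OF assms(1)]])
    have *: "(\<lambda>x. x j) \<in> borel_measurable (coord_lborel J)" if "j \<in> J" for j
      using that measurable_component_singleton[of j J "\<lambda>_. lborel :: real measure"] by simp
    show "{x \<in> space (coord_lborel J). \<forall>j\<in>J. x i * c J j \<le> x j * c J i} \<in> sets (coord_lborel J)"
      using fin assms(2)
      by (intro sets.sets_Collect_finite_All borel_measurable_le borel_measurable_times * borel_measurable_const)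
  qed
  finally show ?thesis .
qed

lemma trunc_cong: "(\<And>j. j \<in> J \<Longrightarrow> x j = y j) \<Longrightarrow> x \<in> trunc J s \<longleftrightarrow> y \<in> trunc J s"
  by (simp add: trunc_def)

text \<open>For the slices of a pyramid. Membership in \<open>trunc J\<close> ignores values outside
  \<open>J\<close>, so the translation may be restricted to \<open>J\<close>.\<close>

lemma emeasure_trunc_translate:
  assumes "J \<subseteq> I"
  shows "{x. (\<lambda>j. x j - a j) \<in> trunc J r} \<inter> space (coord_lborel J) \<in> sets (coord_lborel J)" (is ?A)
    and "emeasure (coord_lborel J) ({x. (\<lambda>j. x j - a j) \<in> trunc J r} \<inter> space (coord_lborel J)) =
      emeasure (coord_lborel J) (trunc J r \<inter> space (coord_lborel J))" (is ?B)
proof -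
  let ?T = "\<lambda>x. \<lambda>j\<in>J. x j + - a j"
  have T: "?T \<in> measurable (coord_lborel J) (coord_lborel J)"
    by (intro measurable_restrict) auto
  have eq: "?T -` (trunc J r \<inter> space (coord_lborel J)) \<inter> space (coord_lborel J) =
      {x. (\<lambda>j. x j - a j) \<in> trunc J r} \<inter> space (coord_lborel J)"
    using trunc_cong[of J "?T x" "\<lambda>j. x j - a j" r for x] by (auto simp: space_PiM)
  show ?A using measurable_sets[OF T sets_trunc[OF assms, of r]] eq by simp
  have "emeasure (coord_lborel J) (trunc J r \<inter> space (coord_lborel J)) =
      emeasure (distr (coord_lborel J) (coord_lborel J) ?T) (trunc J r \<inter> space (coord_lborel J))"
    using finite_subset_I[OF assms] by (simp only: distr_coord_lborel_translation)
  also have "\<dots> = emeasure (coord_lborel J) ({x. (\<lambda>j. x j - a j) \<in> trunc J r} \<inter> space (coord_lborel J))"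
    using T sets_trunc[OF assms, of r] by (simp only: emeasure_distr eq)
  finally show ?B by simp
qed

lemma ordering_sum_nonneg:
  assumes "J \<subseteq> I"
  shows "0 \<le> ordering_sum c J"
  unfolding ordering_sum_def
proof (intro sum_nonneg prod_nonneg)
  fix f j assume f: "f \<in> orderings J" and j: "j \<in> {1..card J}"
  then have "f ` {1..j} \<subseteq> I"
    using assms by (auto simp: orderings_def bij_betw_def)
  then show "0 \<le> c (f ` {1..j}) (f j)"
    using j by (intro c_nonneg) auto
qed

text \<open>Integrate the slice volumes \<open>(s - y / c) ^ m * V\<close> over \<open>y\<close>
  from 0 to \<open>s * c\<close>, where \<open>c\<close> is coordinate \<open>i\<close> of the apex
  and \<open>m = card J\<close>. The hypothesis \<open>IH\<close> ranges over all \<open>r\<close>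
  because each slice has its own parameter.\<close>

lemma emeasure_piece:
  assumes J: "insert i J \<subseteq> I" and i: "i \<notin> J" and ci: "0 < c (insert i J) i" and s: "0 \<le> s"
    and IH: "\<And>r. 0 \<le> r \<Longrightarrow> emeasure (coord_lborel J) (trunc J r \<inter> space (coord_lborel J)) =
      ennreal (r ^ card J * V)" and V: "0 \<le> V"
  shows "emeasure (coord_lborel (insert i J)) (piece (insert i J) i s \<inter> space (coord_lborel (insert i J))) =
    ennreal (s ^ Suc (card J) * (c (insert i J) i * V / Suc (card J)))"
proof -
  let ?K = "insert i J" let ?m = "card J"
  define ci' where "ci' = c ?K i"
  have c0: "0 < ci'" using ci by (simp add: ci'_def)
  have fin: "finite J" and JI: "J \<subseteq> I" using J finite_subset_I by auto
  let ?P = "piece ?K i s \<inter> space (coord_lborel ?K)"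
  let ?T = "\<lambda>y. {x. (\<lambda>j. x j - y / ci' * c ?K j) \<in> trunc J (s - y / ci')} \<inter> space (coord_lborel J)"
  have P: "?P \<in> sets (coord_lborel ?K)" using J by (intro sets_piece) auto
  have "emeasure (coord_lborel ?K) ?P = (\<integral>\<^sup>+ x. indicator ?P x \<partial>coord_lborel ?K)"
    using P by simp
  also have "\<dots> = (\<integral>\<^sup>+ y. \<integral>\<^sup>+ x. indicator ?P (x(i := y)) \<partial>coord_lborel J \<partial>lborel)"
    using P fin i by (intro lborel_product.product_nn_integral_insert_rev) auto
  also have "\<dots> = (\<integral>\<^sup>+ y. \<integral>\<^sup>+ x. indicator {0..s * ci'} y * indicator (?T y) x \<partial>coord_lborel J \<partial>lborel)"
  proof (intro nn_integral_cong)
    fix x y assume "x \<in> space (coord_lborel J)"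
    then have "x(i := y) \<in> space (coord_lborel ?K)"
      by (auto simp: space_PiM PiE_def extensional_def)
    with \<open>x \<in> space (coord_lborel J)\<close>
    show "(indicator ?P (x(i := y)) :: ennreal) = indicator {0..s * ci'} y * indicator (?T y) x"
      using piece_slice[of i J x y s, OF J i ci] by (auto simp: indicator_def ci'_def)
  qed
  also have "\<dots> = (\<integral>\<^sup>+ y. indicator {0..s * ci'} y * emeasure (coord_lborel J) (?T y) \<partial>lborel)"
    using emeasure_trunc_translate(1)[OF JI] by (intro nn_integral_cong, subst nn_integral_cmult) auto
  also have "\<dots> = (\<integral>\<^sup>+ y. ennreal ((s - y / ci') ^ ?m * V) * indicator {0..s * ci'} y \<partial>lborel)"
  proof (intro nn_integral_cong)
    fix y
    show "indicator {0..s * ci'} y * emeasure (coord_lborel J) (?T y) =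
        ennreal ((s - y / ci') ^ ?m * V) * indicator {0..s * ci'} y"
    proof (cases "y \<in> {0..s * ci'}")
      case True
      then have "0 \<le> s - y / ci'" using c0 by (simp add: field_simps)
      then show ?thesis
        by (simp only: emeasure_trunc_translate(2)[OF JI] IH mult.commute)
    qed simp
  qed
  \<comment> \<open>The antiderivative vanishes at the upper end \<open>y = s * ci'\<close>, which
    is the apex, so only the value at the base \<open>y = 0\<close> remains.\<close>
  also have "\<dots> = ennreal (- (ci' * (s - s * ci' / ci') ^ Suc ?m / Suc ?m * V)
      - (- (ci' * (s - 0 / ci') ^ Suc ?m / Suc ?m * V)))"
  proof (rule nn_integral_FTC_Icc)
    fix y assume "y \<in> {0..s * ci'}"
    then have "0 \<le> s - y / ci'" using c0 by (simp add: field_simps)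
    then show "0 \<le> (s - y / ci') ^ ?m * V" using V by simp
    have "((\<lambda>y. - (ci' * (s - y / ci') ^ n / n * V)) has_real_derivative
        (s - y / ci') ^ (n - 1) * V) (at y)" if "0 < n" for n :: nat
    proof -
      have "((\<lambda>y. s - y / ci') has_real_derivative - (1 / ci')) (at y)"
        using c0 by (auto intro!: derivative_eq_intros)
      from DERIV_cmult[OF DERIV_power[OF this, of n], of "- (ci' * V / n)"]
      show ?thesis using c0 that by (simp add: mult_ac)
    qed
    from this[of "Suc ?m"] show "((\<lambda>y. - (ci' * (s - y / ci') ^ Suc ?m / Suc ?m * V)) has_real_derivative
        (s - y / ci') ^ ?m * V) (at y)"
      by (simp del: power_Suc of_nat_Suc)
  qed (use s c0 in auto)
  also have "\<dots> = ennreal (s ^ Suc ?m * (ci' * V / Suc ?m))"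
    using c0 by (simp add: field_simps)
  finally show ?thesis by (simp add: ci'_def)
qed

lemma emeasure_trunc:
  assumes "J \<subseteq> I" "0 \<le> s"
  shows "emeasure (coord_lborel J) (trunc J s \<inter> space (coord_lborel J)) =
    ennreal (s ^ card J * (ordering_sum c J / fact (card J)))"
  using finite_subset_I[OF assms(1)] assms
proof (induction J arbitrary: s rule: finite_psubset_induct)
  case (psubset J)
  note J = psubset.prems(1) and s = psubset.prems(2)
  have fin: "finite J" by fact
  let ?M = "coord_lborel J" let ?n = "card J"
  show ?case
  proof (cases "J = {}")
    case True
    then show ?thesis by (simp add: PiM_empty trunc_def)
  next
    case False
    have rec: "ordering_sum c J = (\<Sum>i\<in>J. c J i * ordering_sum c (J - {i}))"
      by (rule ordering_sum_rec[OF fin False])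
    have n: "0 < ?n" using fin False by (simp add: card_gt_0_iff)
    show ?thesis
    proof (cases "\<exists>i\<in>J. c J i \<noteq> 0")
      \<comment> \<open>With a zero apex the polytope lies in a coordinate hyperplane, which is null
        since \<open>J\<close> is nonempty; every term of the recursion is 0 as well.\<close>
      case c0: False
      obtain i where i: "i \<in> J" using False by auto
      have null: "{x \<in> space ?M. x i = 0} \<in> null_sets ?M"
        using i fin by (intro null_sets_coord_graph) auto
      have "trunc J s \<inter> space ?M \<subseteq> {x \<in> space ?M. x i = 0}"
        using trunc_eq_0[OF J _ _ i] c0 by blast
      then have "emeasure ?M (trunc J s \<inter> space ?M) = 0"
        using null unfolding null_sets_def by (blast intro: emeasure_eq_0)
      moreover have "ordering_sum c J = 0"
        unfolding rec using c0 by (intro sum.neutral) auto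
      ultimately show ?thesis by simp
    next
      case True
      define K where "K = {i \<in> J. 0 < c J i}"
      let ?P = "\<lambda>i. piece J i s \<inter> space ?M"
      have K: "finite K" "K \<subseteq> J" using fin by (auto simp: K_def)
      have P: "emeasure ?M (?P i) = ennreal (s ^ ?n * (c J i * ordering_sum c (J - {i}) / fact ?n))"
        if "i \<in> K" for i
      proof -
        have iJ: "i \<in> J" using that K by auto
        have ins: "insert i (J - {i}) = J" using iJ by auto
        have cn: "Suc (card (J - {i})) = ?n" using iJ n by simp
        have V0: "0 \<le> ordering_sum c (J - {i}) / fact (card (J - {i}))"
          using J by (intro divide_nonneg_nonneg ordering_sum_nonneg) auto
        have "emeasure ?M (?P i) =
            ennreal (s ^ ?n * (c J i * (ordering_sum c (J - {i}) / fact (card (J - {i}))) / ?n))"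
          using emeasure_piece[of i "J - {i}" s, unfolded ins cn, OF J _ _ s psubset.IH V0]
            that iJ J by (auto simp: K_def)
        also have "fact ?n = ?n * (fact (card (J - {i})) :: real)"
          using cn by (metis fact_Suc of_nat_fact of_nat_mult)
        ultimately show ?thesis by (simp add: mult.commute)
      qed
      have fm: "?P i \<in> fmeasurable ?M" if "i \<in> K" for i
        using that K J P[OF that] by (intro fmeasurableI sets_piece) auto
      have "pairwise (\<lambda>i j. AE x in ?M. x \<notin> ?P i \<or> x \<notin> ?P j) K"
      proof (rule pairwiseI)
        fix i j assume ij: "i \<in> K" "j \<in> K" "i \<noteq> j"
        \<comment> \<open>A point in both pieces has equal ratios at \<open>i\<close> and
          \<open>j\<close>. This hyperplane is a graph over the coordinates other than
          \<open>i\<close>.\<close>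
        let ?N = "{x \<in> space ?M. x i = x j * c J i / c J j}"
        have "?N \<in> null_sets ?M"
          using ij K fin by (intro null_sets_coord_graph) auto
        moreover have "x \<in> ?N" if "x \<in> ?P i" "x \<in> ?P j" for x
        proof -
          have "x i * c J j = x j * c J i"
            using that ij K by (intro antisym) (auto simp: piece_def)
          then show ?thesis using that ij by (auto simp: K_def field_simps)
        qed
        ultimately show "AE x in ?M. x \<notin> ?P i \<or> x \<notin> ?P j"
          by (intro AE_I'[of ?N]) auto
      qed
      then have "measure ?M (\<Union>i\<in>K. ?P i) = (\<Sum>i\<in>K. measure ?M (?P i))"
        using fm K by (intro measure_UNION_AE) auto
      also have "(\<Union>i\<in>K. ?P i) = trunc J s \<inter> space ?M"
        using trunc_eq_pieces[OF J True] by (auto simp: K_def)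
      also have "(\<Sum>i\<in>K. measure ?M (?P i)) =
          (\<Sum>i\<in>K. s ^ ?n * (c J i * ordering_sum c (J - {i}) / fact ?n))"
      proof (intro sum.cong refl)
        fix i assume i: "i \<in> K"
        have "0 \<le> ordering_sum c (J - {i})" using J by (intro ordering_sum_nonneg) auto
        then show "measure ?M (?P i) = s ^ ?n * (c J i * ordering_sum c (J - {i}) / fact ?n)"
          using P[OF i] i s by (simp add: measure_def K_def)
      qed
      \<comment> \<open>Indices outside \<open>K\<close> have \<open>c J i = 0\<close>, so including
        them adds nothing.\<close>
      also have "\<dots> = (\<Sum>i\<in>J. s ^ ?n * (c J i * ordering_sum c (J - {i}) / fact ?n))"
        using fin c_nonneg[OF J] by (intro sum.mono_neutral_left) (force simp: K_def)+
      also have "\<dots> = s ^ ?n * (ordering_sum c J / fact ?n)"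
        by (simp add: rec sum_distrib_left sum_divide_distrib)
      finally have m: "measure ?M (trunc J s \<inter> space ?M) = s ^ ?n * (ordering_sum c J / fact ?n)" .
      have "trunc J s \<inter> space ?M \<in> fmeasurable ?M"
        using fmeasurable.finite_UN[of K ?P ?M] fm K(1) trunc_eq_pieces[OF J True, of s]
        by (simp add: K_def Int_UN_distrib2)
      then show ?thesis using m by (simp add: emeasure_eq_measure2)
    qed
  qed
qed

end

section \<open>Determinants over a finite index set\<close>

text \<open>The injection \<open>g\<close> places the index set inside a finite type, so that
  determinants over a set can be treated as determinants of matrices.\<close>

locale finite_index =
  fixes I :: "'i set" and g :: "'i \<Rightarrow> 'n::{finite,wellorder}"
  assumes fin: "finite I" and inj: "inj_on g I"
begin

text \<open>Block form: \<open>A\<close> on the image of \<open>I\<close> and the identity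
  elsewhere. The determinant is unchanged and the additional coordinates stay fixed.\<close>

definition ext :: "('i \<Rightarrow> 'i \<Rightarrow> real) \<Rightarrow> ((real, 'n) vec, 'n) vec" where
  "ext A = (\<chi> a b. if a \<in> g ` I \<and> b \<in> g ` I then A (inv_into I g a) (inv_into I g b)
                   else if a = b then 1 else 0)"

definition pad :: "('i \<Rightarrow> real) \<Rightarrow> (real, 'n) vec" where
  "pad x = (\<chi> a. if a \<in> g ` I then x (inv_into I g a) else 0)"

lemma sum_range: "(\<Sum>a\<in>UNIV. if a \<in> g ` I then h (inv_into I g a) else 0) = (\<Sum>i\<in>I. h i :: real)"
proof -
  have "(\<Sum>a\<in>UNIV. if a \<in> g ` I then h (inv_into I g a) else 0) = (\<Sum>a\<in>g ` I. h (inv_into I g a))"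
    by (simp add: sum.If_cases)
  also have "\<dots> = (\<Sum>i\<in>I. h i)"
    using inj by (simp add: sum.reindex)
  finally show ?thesis .
qed

lemma ext_mult_vec:
  "(ext A *v v) $ a = (if a \<in> g ` I then \<Sum>j\<in>I. A (inv_into I g a) j * v $ g j else v $ a)"
proof (cases "a \<in> g ` I")
  case True
  have "(ext A *v v) $ a = (\<Sum>b\<in>UNIV. if b \<in> g ` I
      then A (inv_into I g a) (inv_into I g b) * v $ g (inv_into I g b) else 0)"
    unfolding matrix_vector_mult_def using True
    by (auto simp: ext_def f_inv_into_f intro!: sum.cong)
  then show ?thesis using True by (simp add: sum_range[of "\<lambda>j. A (inv_into I g a) j * v $ g j"])
next
  case False
  have "(ext A *v v) $ a = (\<Sum>b\<in>UNIV. if b = a then v $ b else 0)"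
    unfolding matrix_vector_mult_def using False
    by (subst vec_lambda_beta, intro sum.cong) (auto simp: ext_def)
  then show ?thesis using False by simp
qed

lemma ext_mult_pad: "ext A *v pad x = pad (\<lambda>i. \<Sum>j\<in>I. A i j * x j)"
  using inj by (auto simp: vec_eq_iff ext_mult_vec pad_def intro!: sum.cong)

text \<open>A permutation that moves an index outside the image of \<open>I\<close> picks an
  off-diagonal zero of \<open>ext A\<close>. The remaining ones are the permutations of
  \<open>I\<close> transported along \<open>g\<close>, with the same sign.\<close>

lemma det_on_eq_det: "det_on I A = det (ext A)"
proof -
  let ?F = "\<lambda>q. of_int (sign q) * (\<Prod>a\<in>UNIV. ext A $ a $ q a)"
  let ?m = "map_permutation I g"
  have bij: "bij_betw g I (g ` I)" using inj by (simp add: bij_betw_def)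
  have "det (ext A) = (\<Sum>q | q permutes UNIV. ?F q)"
    by (simp add: det_def)
  also have "\<dots> = (\<Sum>q | q permutes (g ` I). ?F q)"
  proof (rule sum.mono_neutral_right)
    show "{q. q permutes g ` I} \<subseteq> {q. q permutes UNIV}"
      using permutes_subset by blast
    show "\<forall>q\<in>{q. q permutes UNIV} - {q. q permutes g ` I}. ?F q = 0"
    proof
      fix q assume "q \<in> {q. q permutes UNIV} - {q. q permutes g ` I}"
      then have q: "q permutes UNIV" "\<not> q permutes g ` I" by auto
      then obtain a where a: "a \<notin> g ` I" "q a \<noteq> a"
        using permutes_superset[of q UNIV "g ` I"] by blast
      then have "ext A $ a $ q a = 0" by (auto simp: ext_def)
      then show "?F q = 0" by (auto simp: prod_zero_iff)
    qed
  qed simp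
  also have "\<dots> = (\<Sum>p | p permutes I. ?F (?m p))"
  proof (rule sum.reindex_bij_betw[symmetric])
    have "?m p = (\<lambda>x. if x \<in> g ` I then g (p (inv_into I g x)) else x)" for p
      by (auto simp: map_permutation_def restrict_id_def)
    then show "bij_betw ?m {p. p permutes I} {q. q permutes g ` I}"
      using bij_betw_permutations[OF bij] by presburger
  qed
  also have "\<dots> = det_on I A"
    unfolding det_on_def
  proof (intro sum.cong refl arg_cong2[where f = "(*)"])
    fix p assume "p \<in> {p. p permutes I}"
    then have p: "p permutes I" by simp
    show "of_int (sign (?m p)) = (of_int (sign p) :: real)"
      using p inj fin by (simp add: sign_map_permutation)
    have "(\<Prod>a\<in>UNIV. ext A $ a $ ?m p a) = (\<Prod>a\<in>g ` I. ext A $ a $ ?m p a)"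
      by (rule prod.mono_neutral_right) (auto simp: ext_def map_permutation_def restrict_id_def)
    also have "\<dots> = (\<Prod>i\<in>I. ext A $ g i $ ?m p (g i))"
      using inj by (simp add: prod.reindex)
    also have "\<dots> = (\<Prod>i\<in>I. A i (p i))"
    proof (rule prod.cong)
      fix i assume i: "i \<in> I"
      then have "p i \<in> I" using p by (simp add: permutes_in_image)
      then show "ext A $ g i $ ?m p (g i) = A i (p i)"
        using i inj by (simp add: ext_def map_permutation_apply)
    qed simp
    finally show "(\<Prod>a\<in>UNIV. ext A $ a $ ?m p a) = (\<Prod>i\<in>I. A i (p i))" .
  qed
  finally show ?thesis ..
qed

text \<open>Replacing column \<open>r\<close> by \<open>A x\<close> multiplies the determinant by
  \<open>x r\<close>. This identifies the determinants \<open>gram_replace_det\<close> with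
  multiples of apex coordinates.\<close>

lemma det_on_cramer:
  fixes A :: "'i \<Rightarrow> 'i \<Rightarrow> real"
  assumes r: "r \<in> I" and eq: "\<And>i. i \<in> I \<Longrightarrow> (\<Sum>j\<in>I. A i j * x j) = y i"
  shows "det_on I (\<lambda>i j. if j = r then y i else A i j) = x r * det_on I A"
proof -
  have "pad (\<lambda>i. \<Sum>j\<in>I. A i j * x j) = pad y"
    using eq by (auto simp: pad_def vec_eq_iff inv_into_into)
  then have 1: "ext A *v pad x = pad y" by (simp add: ext_mult_pad)
  have 2: "inv_into I g b = r \<longleftrightarrow> b = g r" if "b \<in> g ` I" for b
    using that r inj by auto
  have "ext (\<lambda>i j. if j = r then y i else A i j) =
      (\<chi> a b. if b = g r then (ext A *v pad x) $ a else ext A $ a $ b)"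
    using r 2 unfolding 1 by (auto simp: vec_eq_iff ext_def pad_def)
  moreover have "pad x $ g r = x r" using r inj by (simp add: pad_def)
  ultimately show ?thesis
    using cramer_lemma[of "g r" "ext A" "pad x"] by (simp only: det_on_eq_det)
qed

lemma det_on_id: "det_on I (\<lambda>i j. if i = j then 1 else 0) = (1 :: real)"
proof -
  have "ext (\<lambda>i j. if i = j then 1 else 0) = mat 1"
    using inj by (auto simp: vec_eq_iff ext_def mat_def)
  then show ?thesis by (simp add: det_on_eq_det)
qed

lemma det_on_mult: "det_on I (\<lambda>i j. \<Sum>l\<in>I. A i l * B l j) = det_on I A * (det_on I B :: real)"
proof -
  have "ext (\<lambda>i j. \<Sum>l\<in>I. A i l * B l j) = ext A ** ext B"
  proof -
    have "ext (\<lambda>i j. \<Sum>l\<in>I. A i l * B l j) *v v = (ext A ** ext B) *v v" for v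
    proof -
      have "(\<Sum>j\<in>I. (\<Sum>l\<in>I. A i l * B l j) * v $ g j) =
          (\<Sum>l\<in>I. A i l * (\<Sum>j\<in>I. B l j * v $ g j))" for i
      proof -
        have "(\<Sum>j\<in>I. (\<Sum>l\<in>I. A i l * B l j) * v $ g j) = (\<Sum>j\<in>I. \<Sum>l\<in>I. A i l * B l j * v $ g j)"
          by (simp add: sum_distrib_right)
        also have "\<dots> = (\<Sum>l\<in>I. \<Sum>j\<in>I. A i l * B l j * v $ g j)" by (rule sum.swap)
        finally show ?thesis by (simp add: sum_distrib_left mult.assoc)
      qed
      then show ?thesis
        using inj by (auto simp: vec_eq_iff ext_mult_vec matrix_vector_mul_assoc[symmetric] intro!: sum.cong)
    qed
    then show ?thesis by (simp add: matrix_eq)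
  qed
  then show ?thesis by (simp add: det_on_eq_det det_mul)
qed

lemma det_on_nonzero:
  assumes "\<And>x. (\<And>i. i \<in> I \<Longrightarrow> (\<Sum>j\<in>I. A i j * x j) = 0) \<Longrightarrow> \<forall>i\<in>I. x i = 0"
  shows "det_on I A \<noteq> (0 :: real)"
proof -
  have "v = 0" if v: "ext A *v v = 0" for v
  proof -
    have "(\<Sum>j\<in>I. A i j * v $ g j) = 0" if "i \<in> I" for i
      using arg_cong[OF v, of "\<lambda>w. w $ g i"] that inj by (simp add: ext_mult_vec)
    from assms[OF this] have "v $ a = 0" if "a \<in> g ` I" for a using that by auto
    moreover have "v $ a = 0" if "a \<notin> g ` I" for a
      using arg_cong[OF v, of "\<lambda>w. w $ a"] that by (simp add: ext_mult_vec)
    ultimately show ?thesis by (metis vec_eq_iff zero_index)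
  qed
  then have "invertible (ext A)"
    using matrix_left_invertible_ker[of "ext A"] by (simp add: invertible_left_inverse)
  then show ?thesis by (simp add: det_on_eq_det invertible_det_nz)
qed

lemma det_on_solve:
  assumes "det_on I A \<noteq> (0 :: real)"
  obtains x where "\<And>i. i \<in> I \<Longrightarrow> (\<Sum>j\<in>I. A i j * x j) = y i"
proof -
  obtain v where v: "ext A *v v = pad y"
    using cramer[of "ext A" _ "pad y"] assms by (auto simp: det_on_eq_det)
  have "(\<Sum>j\<in>I. A i j * v $ g j) = y i" if "i \<in> I" for i
    using arg_cong[OF v, of "\<lambda>w. w $ g i"] that inj by (simp add: ext_mult_vec pad_def)
  then show ?thesis by (rule that)
qed

text \<open>The determinant does not vanish along the segment from the identity to \<open>A\<close>.\<close>

lemma det_on_pos: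
  assumes pos: "\<And>x. \<exists>i\<in>I. x i \<noteq> 0 \<Longrightarrow> 0 < (\<Sum>i\<in>I. x i * (\<Sum>j\<in>I. A i j * x j))"
  shows "0 < (det_on I A :: real)"
proof (rule ccontr)
  assume neg: "\<not> 0 < det_on I A"
  let ?\<delta> = "\<lambda>i j. if i = j then 1 else 0 :: real"
  define D where "D = (\<lambda>t. det_on I (\<lambda>i j. (1 - t) * ?\<delta> i j + t * A i j))"
  have cont: "continuous_on {0..1} D"
    unfolding D_def det_on_def by (intro continuous_intros)
  have "D 1 \<le> 0" "0 \<le> D 0" using neg by (simp_all add: D_def det_on_id)
  then obtain t where t: "0 \<le> t" "t \<le> 1" "D t = 0"
    using IVT2'[of D 1 0 0] cont by auto
  \<comment> \<open>A convex combination of positive definite forms is positive definite: pairing a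
    kernel vector \<open>x\<close> with its image gives \<open>1 - t\<close> times the sum of
    squares plus \<open>t * ?Q\<close>, which is positive unless \<open>x\<close> vanishes on
    \<open>I\<close>.\<close>
  have "D t \<noteq> 0"
    unfolding D_def
  proof (rule det_on_nonzero, rule ccontr)
    fix x
    assume x: "\<And>i. i \<in> I \<Longrightarrow> (\<Sum>j\<in>I. ((1 - t) * ?\<delta> i j + t * A i j) * x j) = 0"
      and nz: "\<not> (\<forall>i\<in>I. x i = 0)"
    let ?Q = "\<Sum>i\<in>I. x i * (\<Sum>j\<in>I. A i j * x j)"
    have "(\<Sum>j\<in>I. ((1 - t) * ?\<delta> i j + t * A i j) * x j) =
        (1 - t) * x i + t * (\<Sum>j\<in>I. A i j * x j)" if "i \<in> I" for i
    proof -
      have "(\<Sum>j\<in>I. ((1 - t) * ?\<delta> i j + t * A i j) * x j) =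
          (\<Sum>j\<in>I. (if i = j then (1 - t) * x j else 0) + t * (A i j * x j))"
        by (intro sum.cong) (auto simp: algebra_simps)
      then show ?thesis using that fin by (simp add: sum.distrib sum_distrib_left)
    qed
    then have "(\<Sum>i\<in>I. x i * ((1 - t) * x i + t * (\<Sum>j\<in>I. A i j * x j))) = 0"
      using x by (intro sum.neutral) auto
    also have "(\<Sum>i\<in>I. x i * ((1 - t) * x i + t * (\<Sum>j\<in>I. A i j * x j))) =
        (1 - t) * (\<Sum>i\<in>I. x i * x i) + t * ?Q"
      by (simp add: distrib_left sum.distrib sum_distrib_left mult_ac)
    finally have 0: "(1 - t) * (\<Sum>i\<in>I. x i * x i) + t * ?Q = 0" .
    have Q: "0 < ?Q" using pos[of x] nz by auto
    have "0 < (\<Sum>i\<in>I. x i * x i)"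
      using nz fin by (auto intro!: sum_pos2 simp: zero_less_mult_iff linorder_neq_iff)
    then have "0 < (1 - t) * (\<Sum>i\<in>I. x i * x i) + t * ?Q"
      using Q t by (cases "t = 0") (auto intro: add_nonneg_pos)
    then show False using 0 by simp
  qed
  then show False using t by simp
qed

end

lemma det_on_Ints:
  fixes A :: "'i \<Rightarrow> 'i \<Rightarrow> real"
  assumes "\<And>i j. i \<in> I \<Longrightarrow> j \<in> I \<Longrightarrow> A i j \<in> \<int>"
  shows "det_on I A \<in> \<int>"
  unfolding det_on_def
  using assms by (auto intro!: Ints_sum Ints_mult Ints_prod simp: permutes_in_image)

section \<open>Linear change of variables in coordinates\<close>

lemma emeasure_lborel_Basis_box:
  assumes "\<And>b. b \<in> Basis \<Longrightarrow> B b \<in> sets borel"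
  shows "{v :: 'a::euclidean_space. \<forall>b\<in>Basis. v \<bullet> b \<in> B b} \<in> sets borel" (is "?S \<in> _")
    and "emeasure lborel {v :: 'a::euclidean_space. \<forall>b\<in>Basis. v \<bullet> b \<in> B b} =
      (\<Prod>b\<in>Basis. emeasure lborel (B b))"
proof -
  have "?S = (\<Inter>b\<in>Basis. (\<lambda>v. v \<bullet> b) -` B b \<inter> space borel)"
    by auto
  also have "\<dots> \<in> sets borel"
    using assms by (intro sets.finite_INT measurable_sets[of _ borel borel]) auto
  finally show S: "?S \<in> sets borel" .
  have "emeasure lborel ?S = emeasure (coord_lborel Basis)
      ((\<lambda>f. \<Sum>b\<in>Basis. f b *\<^sub>R b) -` ?S \<inter> space (coord_lborel Basis))"
    by (subst lborel_eq, subst emeasure_distr) (use S in auto)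
  also have "(\<lambda>f. \<Sum>b\<in>Basis. f b *\<^sub>R b) -` ?S \<inter> space (coord_lborel Basis) = Pi\<^sub>E Basis B"
    by (auto simp: space_PiM PiE_def Pi_def inner_sum_left inner_Basis if_distrib cong: if_cong)
  also have "emeasure (coord_lborel Basis) \<dots> = (\<Prod>b\<in>Basis. emeasure lborel (B b))"
    using assms by (intro lborel_product.emeasure_PiM) auto
  finally show "emeasure lborel ?S = (\<Prod>b\<in>Basis. emeasure lborel (B b))" .
qed

context finite_index
begin

definition coords :: "(real, 'n) vec \<Rightarrow> 'i \<Rightarrow> real" where
  "coords v = (\<lambda>i\<in>I. v $ g i)"

text \<open>Each additional coordinate ranges over an interval of length 1 and so contributes the
  factor 1; fixing it at 0, as \<open>pad\<close> does, would give a null set.\<close>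

definition unit_pad :: "(real, 'n) vec set" where
  "unit_pad = {v. \<forall>a. a \<notin> g ` I \<longrightarrow> v $ a \<in> {0..1}}"

lemma measurable_coords [measurable]: "coords \<in> measurable borel (coord_lborel I)"
  unfolding coords_def by (intro measurable_restrict) simp

lemma emeasure_lborel_box_vec:
  assumes "\<And>a. B a \<in> sets borel"
  shows "{v :: (real, 'n) vec. \<forall>a. v $ a \<in> B a} \<in> sets borel"
    and "emeasure lborel {v :: (real, 'n) vec. \<forall>a. v $ a \<in> B a} = (\<Prod>a\<in>UNIV. emeasure lborel (B a))"
proof -
  define C where "C = (\<lambda>b :: (real, 'n) vec. B (axis_index b))"
  have ax: "inj (\<lambda>a :: 'n. axis a (1::real))" by (auto simp: inj_on_def axis_eq_axis)
  have Basis: "(Basis :: (real, 'n) vec set) = range (\<lambda>a. axis a 1)"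
    by (auto simp: Basis_vec_def)
  have eq: "{v :: (real, 'n) vec. \<forall>a. v $ a \<in> B a} = {v. \<forall>b\<in>Basis. v \<bullet> b \<in> C b}"
    by (simp add: Basis C_def axis_index_axis cart_eq_inner_axis)
  have C: "C b \<in> sets borel" if "b \<in> Basis" for b using assms by (simp add: C_def)
  show "{v :: (real, 'n) vec. \<forall>a. v $ a \<in> B a} \<in> sets borel"
    using emeasure_lborel_Basis_box(1)[of C] C eq by simp
  have "emeasure lborel {v :: (real, 'n) vec. \<forall>a. v $ a \<in> B a} =
      (\<Prod>b\<in>(Basis :: (real, 'n) vec set). emeasure lborel (C b))"
    unfolding eq by (rule emeasure_lborel_Basis_box(2)[OF C])
  also have "\<dots> = (\<Prod>a\<in>UNIV. emeasure lborel (B a))"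
    unfolding Basis using ax by (simp add: prod.reindex C_def axis_index_axis)
  finally show "emeasure lborel {v :: (real, 'n) vec. \<forall>a. v $ a \<in> B a} =
      (\<Prod>a\<in>UNIV. emeasure lborel (B a))" .
qed

lemma sets_unit_pad [measurable]: "unit_pad \<in> sets borel"
proof -
  have "unit_pad = {v. \<forall>a. v $ a \<in> (if a \<in> g ` I then UNIV else {0..1})}"
    by (auto simp: unit_pad_def)
  then show ?thesis
    using emeasure_lborel_box_vec(1)[of "\<lambda>a. if a \<in> g ` I then UNIV else {0..1}"] by simp
qed

text \<open>Padding by unit intervals realizes Lebesgue measure on the coordinates \<open>I\<close> inside the
  ambient \<open>\<real>\<^sup>n\<close>.\<close>

lemma coord_lborel_eq_distr:
  "coord_lborel I = distr (density lborel (indicator unit_pad)) (coord_lborel I) coords"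
proof (rule lborel_product.PiM_eqI[symmetric])
  fix A :: "'i \<Rightarrow> real set" assume A: "\<And>i. i \<in> I \<Longrightarrow> A i \<in> sets lborel"
  define B where "B a = (if a \<in> g ` I then A (inv_into I g a) else {0..1})" for a
  have B: "B a \<in> sets borel" for a
    using A by (auto simp: B_def inv_into_into)
  have P: "Pi\<^sub>E I A \<in> sets (coord_lborel I)"
    using A fin by (intro sets_PiM_I_finite) auto
  have eq: "unit_pad \<inter> coords -` Pi\<^sub>E I A = {v. \<forall>a. v $ a \<in> B a}"
  proof -
    have "B (g i) = A i" if "i \<in> I" for i using that inj by (simp add: B_def)
    then have "coords v \<in> Pi\<^sub>E I A \<longleftrightarrow> (\<forall>a\<in>g ` I. v $ a \<in> B a)" for v
      by (auto simp: coords_def PiE_def Pi_def)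
    moreover have "v \<in> unit_pad \<longleftrightarrow> (\<forall>a\<in>- g ` I. v $ a \<in> B a)" for v
      by (auto simp: unit_pad_def B_def)
    moreover have "(\<forall>a. v $ a \<in> B a) \<longleftrightarrow>
        (\<forall>a\<in>- g ` I. v $ a \<in> B a) \<and> (\<forall>a\<in>g ` I. v $ a \<in> B a)" for v :: "(real, 'n) vec"
      by blast
    ultimately show ?thesis
      by (simp only: set_eq_iff Int_iff vimage_eq mem_Collect_eq) simp
  qed
  have "emeasure (distr (density lborel (indicator unit_pad)) (coord_lborel I) coords) (Pi\<^sub>E I A) =
      emeasure (density lborel (indicator unit_pad)) (coords -` Pi\<^sub>E I A)"
    using P by (subst emeasure_distr) auto
  also have "\<dots> = emeasure lborel (unit_pad \<inter> coords -` Pi\<^sub>E I A)"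
    using measurable_sets[OF measurable_coords P]
    by (subst emeasure_density) (auto simp: nn_integral_indicator[symmetric] indicator_inter_arith
        simp del: nn_integral_indicator)
  also have "\<dots> = (\<Prod>a\<in>UNIV. emeasure lborel (B a))"
    unfolding eq using B by (rule emeasure_lborel_box_vec)
  also have "\<dots> = (\<Prod>a\<in>g ` I. emeasure lborel (B a))"
    by (rule prod.mono_neutral_right) (auto simp: B_def)
  also have "\<dots> = (\<Prod>i\<in>I. emeasure lborel (A i))"
    using inj by (simp add: prod.reindex B_def)
  finally show "emeasure (distr (density lborel (indicator unit_pad)) (coord_lborel I) coords) (Pi\<^sub>E I A) =
      (\<Prod>i\<in>I. emeasure lborel (A i))" .
qed (use fin in auto)

lemma emeasure_coord_lborel:
  assumes S: "S \<in> sets (coord_lborel I)"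
  shows "emeasure (coord_lborel I) S = emeasure lborel (unit_pad \<inter> coords -` S)"
proof -
  have "emeasure (coord_lborel I) S =
      emeasure (distr (density lborel (indicator unit_pad)) (coord_lborel I) coords) S"
    by (subst coord_lborel_eq_distr) simp
  also have "\<dots> = emeasure (density lborel (indicator unit_pad)) (coords -` S)"
    using S by (subst emeasure_distr) auto
  also have "\<dots> = emeasure lborel (unit_pad \<inter> coords -` S)"
    using measurable_sets[OF measurable_coords S]
    by (subst emeasure_density) (auto simp: nn_integral_indicator[symmetric] indicator_inter_arith
        simp del: nn_integral_indicator)
  finally show ?thesis .
qed

text \<open>The matrix \<open>ext H\<close> fixes the padding coordinates, so it maps the padded
  copy of \<open>S\<close> onto the padded copy of its image, and the determinant formula for linear
  images applies there.\<close>

lemma measure_coord_lborel_linear_image: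
  assumes S: "S \<in> sets (coord_lborel I)" "emeasure (coord_lborel I) S < \<infinity>"
    and HS: "(\<lambda>x. \<lambda>i\<in>I. \<Sum>j\<in>I. H i j * x j) ` S \<in> sets (coord_lborel I)"
  shows "measure (coord_lborel I) ((\<lambda>x. \<lambda>i\<in>I. \<Sum>j\<in>I. H i j * x j) ` S) =
    \<bar>det_on I H\<bar> * measure (coord_lborel I) S"
proof -
  let ?h = "\<lambda>x. \<lambda>i\<in>I. \<Sum>j\<in>I. H i j * x j"
  define pull where "pull S = unit_pad \<inter> coords -` S" for S
  have pull: "pull S \<in> sets borel" if "S \<in> sets (coord_lborel I)" for S
    using measurable_sets[OF measurable_coords that] by (auto simp: pull_def)
  have m: "measure (coord_lborel I) S = measure lebesgue (pull S)"
    if "S \<in> sets (coord_lborel I)" for S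
    using emeasure_coord_lborel[OF that] pull[OF that] by (simp add: measure_def pull_def)
  let ?f = "\<lambda>v. ext H *v v"
  have coords_f: "coords (?f v) = ?h (coords v)" for v
    using inj by (auto simp: coords_def ext_mult_vec fun_eq_iff intro!: sum.cong)
  have pad_f: "?f v \<in> unit_pad \<longleftrightarrow> v \<in> unit_pad" for v
    by (simp add: unit_pad_def ext_mult_vec)
  have "pull (?h ` S) = ?f ` pull S"
  proof
    show "?f ` pull S \<subseteq> pull (?h ` S)"
      using coords_f pad_f by (auto simp: pull_def)
    show "pull (?h ` S) \<subseteq> ?f ` pull S"
    proof
      fix v assume v: "v \<in> pull (?h ` S)"
      then obtain x where x: "x \<in> S" "coords v = ?h x" by (auto simp: pull_def)
      \<comment> \<open>A preimage of \<open>v\<close> is built from \<open>x\<close> on the block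
        and from \<open>v\<close> itself on the padding, so no inverse of \<open>H\<close> is
        involved.\<close>
      define w where "w = (\<chi> a. if a \<in> g ` I then x (inv_into I g a) else v $ a)"
      have xs: "x \<in> extensional I"
        using x(1) sets.sets_into_space[OF S(1)] by (auto simp: space_PiM PiE_def)
      have wx: "coords w = x"
        using xs inj by (auto simp: coords_def w_def extensional_def fun_eq_iff)
      have "(?f w) $ a = v $ a" for a
      proof (cases "a \<in> g ` I")
        case True
        then obtain i where i: "a = g i" "i \<in> I" by auto
        have "coords (?f w) i = coords v i" using coords_f wx x(2) by simp
        then show ?thesis using i by (simp add: coords_def)
      next
        case False
        then show ?thesis by (simp add: ext_mult_vec w_def)
      qed
      then have fw: "?f w = v" by (simp add: vec_eq_iff)
      then have "w \<in> pull S" using v x(1) wx pad_f[of w] by (auto simp: pull_def)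
      then show "v \<in> ?f ` pull S" using fw by blast
    qed
  qed
  moreover have "pull S \<in> lmeasurable"
  proof (rule fmeasurableI)
    show "pull S \<in> sets lebesgue" using pull[OF S(1)] by simp
    show "emeasure lebesgue (pull S) < \<infinity>"
      using S emeasure_coord_lborel[OF S(1)] pull[OF S(1)] by (simp add: pull_def)
  qed
  then have "measure lebesgue (?f ` pull S) = \<bar>det (ext H)\<bar> * measure lebesgue (pull S)"
    using measure_linear_image[of ?f "pull S"] by simp
  ultimately show ?thesis
    by (simp only: m[OF S(1)] m[OF HS] det_on_eq_det)
qed

end

text \<open>The change of variables formula of the library is available on \<open>\<real>\<^sup>n\<close> only, where \<open>n\<close>
  is a type.  This type provides an \<open>n\<close> that is large enough for every independent family in \<open>'a\<close>.\<close>

typedef (overloaded) ('a::euclidean_space) basis_index = "{..<DIM('a)}"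
  by (rule exI[of _ 0]) simp

instantiation basis_index :: (euclidean_space) "{finite, wellorder}"
begin

definition "x \<le> y \<longleftrightarrow> Rep_basis_index x \<le> Rep_basis_index y"
definition "x < y \<longleftrightarrow> Rep_basis_index x < Rep_basis_index y"

instance
proof
  have *: "Abs_basis_index ` {..<DIM('a)} = (UNIV :: 'a basis_index set)"
    by (rule type_definition.Abs_image[OF type_definition_basis_index])
  show "finite (UNIV :: 'a basis_index set)"
    unfolding *[symmetric] by simp
next
  fix P and a :: "'a basis_index"
  assume step: "\<And>x :: 'a basis_index. (\<And>y. y < x \<Longrightarrow> P y) \<Longrightarrow> P x"
  show "P a"
  proof (induction a rule: measure_induct_rule[of Rep_basis_index])
    case (less x)
    show ?case by (rule step) (rule less, simp add: less_basis_index_def)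
  qed
qed (auto simp: less_eq_basis_index_def less_basis_index_def Rep_basis_index_inject)

end

lemma exists_finite_index:
  assumes "finite I" "card I \<le> DIM('a::euclidean_space)"
  obtains g :: "'i \<Rightarrow> 'a::euclidean_space basis_index" where "finite_index I g"
proof -
  have "card (UNIV :: 'a basis_index set) = card {..<DIM('a)}"
    by (rule type_definition.card[OF type_definition_basis_index])
  then have "card I \<le> card (UNIV :: 'a basis_index set)"
    using assms(2) by simp
  from card_le_inj[OF assms(1) finite this]
  obtain g :: "'i \<Rightarrow> 'a basis_index" where "inj_on g I" by auto
  with assms(1) show ?thesis by (intro that[of g]) (simp add: finite_index_def)
qed

section \<open>Cones generated by their rays\<close>

text \<open>The generators form an indexed family so that coefficients can be compared ray by ray;
  for finite \<open>J\<close> this is the convex cone hull.\<close>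

definition nonneg_span :: "('i \<Rightarrow> 'a::real_vector) \<Rightarrow> 'i set \<Rightarrow> 'a set" where
  "nonneg_span u J = {\<Sum>i\<in>J. a i *\<^sub>R u i | a. \<forall>i\<in>J. 0 \<le> a i}"

lemma nonneg_spanI: "(\<And>i. i \<in> J \<Longrightarrow> 0 \<le> a i) \<Longrightarrow> (\<Sum>i\<in>J. a i *\<^sub>R u i) \<in> nonneg_span u J"
  unfolding nonneg_span_def by blast

lemma nonneg_spanE:
  assumes "v \<in> nonneg_span u J"
  obtains a where "\<And>i. i \<in> J \<Longrightarrow> 0 \<le> a i" "v = (\<Sum>i\<in>J. a i *\<^sub>R u i)"
  using assms unfolding nonneg_span_def by blast

lemma generator_in_nonneg_span:
  assumes "finite J" "i \<in> J"
  shows "u i \<in> nonneg_span u J"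
proof -
  have "(\<Sum>j\<in>J. (if j = i then 1 else 0) *\<^sub>R u j) \<in> nonneg_span u J"
    by (rule nonneg_spanI) simp
  also have "(\<Sum>j\<in>J. (if j = i then 1 else 0) *\<^sub>R u j) = u i"
    using assms by (simp add: if_distrib[of "\<lambda>c. c *\<^sub>R _"] cong: if_cong)
  finally show ?thesis .
qed

lemma nonneg_span_eq_hull:
  assumes J: "finite J"
  shows "nonneg_span u J = convex_cone hull (u ` J)"
proof (rule hull_unique[symmetric])
  show "u ` J \<subseteq> nonneg_span u J"
    using generator_in_nonneg_span[OF J] by blast
  show "convex_cone (nonneg_span u J)"
    unfolding convex_cone_iff
  proof (intro conjI ballI allI impI)
    show "0 \<in> nonneg_span u J" using nonneg_spanI[of J "\<lambda>_. 0" u] by simp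
  next
    fix v w assume v: "v \<in> nonneg_span u J" and w: "w \<in> nonneg_span u J"
    obtain a where "\<And>i. i \<in> J \<Longrightarrow> 0 \<le> a i" "v = (\<Sum>i\<in>J. a i *\<^sub>R u i)"
      using v by (rule nonneg_spanE) blast
    moreover obtain b where "\<And>i. i \<in> J \<Longrightarrow> 0 \<le> b i" "w = (\<Sum>i\<in>J. b i *\<^sub>R u i)"
      using w by (rule nonneg_spanE) blast
    ultimately show "v + w \<in> nonneg_span u J"
      using nonneg_spanI[of J "\<lambda>i. a i + b i" u] by (simp add: scaleR_left_distrib sum.distrib)
  next
    fix v and r :: real assume v: "v \<in> nonneg_span u J" and "0 \<le> r"
    obtain a where "\<And>i. i \<in> J \<Longrightarrow> 0 \<le> a i" "v = (\<Sum>i\<in>J. a i *\<^sub>R u i)"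
      using v by (rule nonneg_spanE) blast
    then show "r *\<^sub>R v \<in> nonneg_span u J"
      using nonneg_spanI[of J "\<lambda>i. r * a i" u] \<open>0 \<le> r\<close> by (simp add: scaleR_sum_right)
  qed
next
  fix T assume T: "u ` J \<subseteq> T" "convex_cone T"
  have "(\<Sum>i\<in>K. a i *\<^sub>R u i) \<in> T" if "finite K" "K \<subseteq> J" "\<And>i. i \<in> J \<Longrightarrow> 0 \<le> a i" for K a
    using that(1,2)
  proof (induction K)
    case empty
    then show ?case using T(2) by (simp add: convex_cone_contains_0)
  next
    case (insert i K)
    then have "a i *\<^sub>R u i \<in> T" using T that(3) by (auto intro!: convex_cone_scaleR)
    then show ?case using insert T(2) by (auto intro!: convex_cone_add)
  qed
  then show "nonneg_span u J \<subseteq> T" using J by (auto elim!: nonneg_spanE)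
qed

lemma sum_coeffs_unique:
  assumes "finite I" "inj_on u I" "independent (u ` I)"
    and eq: "(\<Sum>i\<in>I. a i *\<^sub>R u i) = (\<Sum>i\<in>I. b i *\<^sub>R u i)" and i: "i \<in> I"
  shows "a i = (b i :: real)"
proof -
  let ?c = "\<lambda>v. a (inv_into I u v) - b (inv_into I u v)"
  have "(\<Sum>v\<in>u ` I. ?c v *\<^sub>R v) = (\<Sum>i\<in>I. (a i - b i) *\<^sub>R u i)"
    using assms(2) by (simp add: sum.reindex)
  also have "\<dots> = 0"
    using eq by (simp add: scaleR_left_diff_distrib sum_subtractf)
  finally have "?c (u i) = 0"
    using assms(1,3) i by (intro independentD[of "u ` I" "u ` I" ?c]) auto
  then show ?thesis using i assms(2) by simp
qed

text \<open>The negative of one summand is the sum of the others, hence also in the cone.\<close>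

lemma strongly_convex_sum_zero:
  assumes "strongly_convex \<sigma>" "convex_cone \<sigma>" "finite T"
    and mem: "\<And>v. v \<in> T \<Longrightarrow> w v \<in> \<sigma>" and sum: "(\<Sum>v\<in>T. w v) = 0" and v: "v \<in> T"
  shows "w v = 0"
proof -
  have "(\<Sum>v\<in>K. w v) \<in> \<sigma>" if "K \<subseteq> T" for K
    using finite_subset[OF that assms(3)] that
  proof (induction K)
    case empty
    then show ?case using assms(2) by (simp add: convex_cone_contains_0)
  next
    case (insert i K)
    then show ?case using mem assms(2) by (auto intro!: convex_cone_add)
  qed
  then have "(\<Sum>v\<in>T - {v}. w v) \<in> \<sigma>" by simp
  moreover have "- w v = (\<Sum>v\<in>T - {v}. w v)"
    using sum v assms(3) by (simp add: sum.remove[of T v] neg_eq_iff_add_eq_0)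
  ultimately show ?thesis
    using assms(1) mem[OF v] by (simp add: strongly_convex_def)
qed

text \<open>Suppose \<open>c *\<^sub>R t\<close> lies between \<open>a\<close> and \<open>b\<close>,
  and let \<open>\<gamma>\<close> be the combined coefficients. Irredundancy gives
  \<open>c \<le> \<gamma> t\<close>, since otherwise \<open>t\<close> would be a nonnegative
  combination of the other generators. Moving everything to one side leaves cone elements with sum
  0, and strong convexity makes each of them 0. So \<open>a\<close> and \<open>b\<close> have no
  coefficient away from \<open>t\<close>.\<close>

lemma irredundant_generator_ray:
  assumes T: "finite T" "t \<in> T" and sc: "strongly_convex (convex_cone hull T)"
    and irr: "\<And>v. v \<in> T \<Longrightarrow> v \<notin> convex_cone hull (T - {v})"
  shows "{c *\<^sub>R t | c. 0 \<le> c} \<in> cone_rays (convex_cone hull T)" (is "?R \<in> cone_rays ?\<sigma>")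
proof -
  have hull: "?\<sigma> = nonneg_span (\<lambda>v. v) T" using nonneg_span_eq_hull[OF T(1), of "\<lambda>v. v"] by simp
  have cc: "convex_cone ?\<sigma>" by (rule convex_cone_convex_cone_hull)
  have in_hull: "v \<in> ?\<sigma>" if "v \<in> T" for v using that by (rule hull_inc)
  have nz: "v \<noteq> 0" if "v \<in> T" for v
    using irr[OF that] convex_cone_hull_contains_0 by metis
  have "?R face_of ?\<sigma>"
    unfolding face_of_def
  proof (intro conjI ballI impI)
    show "?R \<subseteq> ?\<sigma>"
      using in_hull[OF T(2)] cc by (auto intro: convex_cone_scaleR)
    have "?R = nonneg_span (\<lambda>v. v) {t}"
      by (auto simp: nonneg_span_def)
    then show "convex ?R"
      using convex_convex_cone_hull[of "{t}"] by (simp add: nonneg_span_eq_hull)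
    fix a b x assume ab: "a \<in> ?\<sigma>" "b \<in> ?\<sigma>" and x: "x \<in> ?R" "x \<in> open_segment a b"
    obtain c where c: "x = c *\<^sub>R t" "0 \<le> c" using x(1) by auto
    obtain r where r: "0 < r" "r < 1" "x = (1 - r) *\<^sub>R a + r *\<^sub>R b"
      using x(2) by (auto simp: in_segment)
    obtain \<alpha> where \<alpha>: "\<And>v. v \<in> T \<Longrightarrow> 0 \<le> \<alpha> v" "a = (\<Sum>v\<in>T. \<alpha> v *\<^sub>R v)"
      using ab(1) unfolding hull by (rule nonneg_spanE) blast
    obtain \<beta> where \<beta>: "\<And>v. v \<in> T \<Longrightarrow> 0 \<le> \<beta> v" "b = (\<Sum>v\<in>T. \<beta> v *\<^sub>R v)"
      using ab(2) unfolding hull by (rule nonneg_spanE) blast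
    define \<gamma> where "\<gamma> v = (1 - r) * \<alpha> v + r * \<beta> v" for v
    have \<gamma>0: "0 \<le> \<gamma> v" if "v \<in> T" for v
      using \<alpha>(1)[OF that] \<beta>(1)[OF that] r by (simp add: \<gamma>_def)
    have "x = (\<Sum>v\<in>T. \<gamma> v *\<^sub>R v)"
      unfolding r(3) \<alpha>(2) \<beta>(2)
      by (simp add: \<gamma>_def scaleR_sum_right scaleR_left_distrib sum.distrib)
    then have x\<gamma>: "c *\<^sub>R t = \<gamma> t *\<^sub>R t + (\<Sum>v\<in>T - {t}. \<gamma> v *\<^sub>R v)"
      using T by (simp add: c(1) sum.remove[of T t])
    have "c \<le> \<gamma> t"
    proof (rule ccontr)
      assume "\<not> c \<le> \<gamma> t"
      then have d: "0 < c - \<gamma> t" by simp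
      have "(\<Sum>v\<in>T - {t}. \<gamma> v *\<^sub>R v) \<in> nonneg_span (\<lambda>v. v) (T - {t})"
        using \<gamma>0 by (intro nonneg_spanI) auto
      then have "(c - \<gamma> t) *\<^sub>R t \<in> convex_cone hull (T - {t})"
        using x\<gamma> T by (simp add: nonneg_span_eq_hull scaleR_left_diff_distrib)
      then have "inverse (c - \<gamma> t) *\<^sub>R (c - \<gamma> t) *\<^sub>R t \<in> convex_cone hull (T - {t})"
        by (rule convex_cone_hull_mul) (use d in simp)
      moreover have "inverse (c - \<gamma> t) * (c - \<gamma> t) = 1" using d by (intro left_inverse) simp
      ultimately show False using irr[OF T(2)] by (simp only: scaleR_scaleR scaleR_one)
    qed
    define w where "w v = (if v = t then (\<gamma> t - c) *\<^sub>R t else \<gamma> v *\<^sub>R v)" for v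
    have "(\<Sum>v\<in>T. w v) = (\<gamma> t - c) *\<^sub>R t + (\<Sum>v\<in>T - {t}. \<gamma> v *\<^sub>R v)"
      using T by (simp add: sum.remove[of T t] w_def)
    also have "\<dots> = 0" using x\<gamma> by (simp add: scaleR_left_diff_distrib)
    finally have w0: "(\<Sum>v\<in>T. w v) = 0" .
    have w\<sigma>: "w v \<in> ?\<sigma>" if "v \<in> T" for v
      using in_hull[OF that] in_hull[OF T(2)] \<gamma>0[OF that] \<open>c \<le> \<gamma> t\<close> cc
      by (auto simp: w_def intro!: convex_cone_scaleR)
    have w: "w v = 0" if "v \<in> T" for v
      by (rule strongly_convex_sum_zero[OF sc cc T(1) w\<sigma> w0 that])
    have \<gamma>z: "\<gamma> v = 0" if "v \<in> T" "v \<noteq> t" for v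
      using that nz[OF that(1)] w[OF that(1)] by (simp add: w_def)
    have \<alpha>\<beta>: "\<alpha> v = 0 \<and> \<beta> v = 0" if "v \<in> T" "v \<noteq> t" for v
    proof -
      have "0 \<le> (1 - r) * \<alpha> v" "0 \<le> r * \<beta> v" "(1 - r) * \<alpha> v + r * \<beta> v = 0"
        using \<alpha>(1) \<beta>(1) \<gamma>z[OF that] that r by (auto simp: \<gamma>_def)
      then show ?thesis using r by (auto simp: add_nonneg_eq_0_iff)
    qed
    have "a = \<alpha> t *\<^sub>R t" "b = \<beta> t *\<^sub>R t"
      unfolding \<alpha>(2) \<beta>(2) using T \<alpha>\<beta> by (simp_all add: sum.remove[of T t])
    then show "a \<in> ?R" "b \<in> ?R" using \<alpha>(1)[OF T(2)] \<beta>(1)[OF T(2)] by auto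
  qed
  moreover have "dim ?R = 1"
  proof -
    have "t \<in> ?R" by (intro CollectI exI[of _ 1]) simp
    then have "{t} \<subseteq> ?R" by blast
    moreover have "?R \<subseteq> span {t}" by (auto simp: span_singleton)
    ultimately have span: "span ?R = span {t}"
      by (intro subset_antisym span_minimal[OF _ subspace_span] span_mono)
    have "dim ?R = dim (span {t})" unfolding span[symmetric] dim_span ..
    also have "\<dots> = 1" using nz[OF T(2)] dim_eq_card_independent[of "{t}"] by simp
    finally show ?thesis .
  qed
  ultimately show ?thesis by (simp add: cone_rays_def)
qed

text \<open>A generating subset of least cardinality cannot lose an element.\<close>

lemma exists_irredundant_generators:
  assumes "finite S"
  obtains T where "T \<subseteq> S" "convex_cone hull T = convex_cone hull S"
    "\<And>v. v \<in> T \<Longrightarrow> v \<notin> convex_cone hull (T - {v})"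
proof -
  let ?P = "\<lambda>T. T \<subseteq> S \<and> convex_cone hull T = convex_cone hull S"
  obtain T where T: "?P T" "\<And>T'. ?P T' \<Longrightarrow> card T \<le> card T'"
    using ex_has_least_nat[of ?P S card] by auto
  have "v \<notin> convex_cone hull (T - {v})" if v: "v \<in> T" for v
  proof
    assume "v \<in> convex_cone hull (T - {v})"
    then have "convex_cone hull (T - {v}) = convex_cone hull T"
      using hull_redundant[of v convex_cone "T - {v}"] v by (simp add: insert_absorb)
    then have "card T \<le> card (T - {v})" using T by (intro T(2)) auto
    then show False
      using v finite_subset[of T S] T(1) assms by (metis card_Diff1_less not_less)
  qed
  then show ?thesis using T(1) that by blast
qed

text \<open>The point \<open>x\<close> lies strictly between \<open>c *\<^sub>R x\<close> and
  another multiple of itself: twice \<open>x\<close> if \<open>c < 1\<close>, the origin if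
  \<open>c > 1\<close>. The face property then captures both endpoints.\<close>

lemma face_of_convex_cone_scaleR:
  assumes \<rho>: "\<rho> face_of \<sigma>" and \<sigma>: "convex_cone \<sigma>" and x: "x \<in> \<rho>" and c: "0 \<le> c"
  shows "c *\<^sub>R x \<in> \<rho>"
proof (cases "x = 0 \<or> c = 1")
  case True
  then show ?thesis using x by auto
next
  case False
  have face: "a \<in> \<rho>" "b \<in> \<rho>" if "x \<in> open_segment a b" "a \<in> \<sigma>" "b \<in> \<sigma>" for a b
    using \<rho> x that by (auto simp: face_of_def)
  have x\<sigma>: "x \<in> \<sigma>" using \<rho> x face_of_imp_subset by blast
  have in\<sigma>: "r *\<^sub>R x \<in> \<sigma>" if "0 \<le> r" for r using that x\<sigma> \<sigma> by (simp add: convex_cone_scaleR)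
  show ?thesis
  proof (cases "c < 1")
    case True
    \<comment> \<open>The solution of \<open>(1 - r) * c + r * 2 = 1\<close>.\<close>
    define r where "r = (1 - c) / (2 - c)"
    have "x = (1 - r) *\<^sub>R (c *\<^sub>R x) + r *\<^sub>R (2 *\<^sub>R x)"
    proof -
      have "(1 - r) * c + r * 2 = 1"
        using True by (simp add: r_def divide_simps)
      then show ?thesis by (metis scaleR_left_distrib scaleR_one scaleR_scaleR)
    qed
    moreover have "c *\<^sub>R x \<noteq> 2 *\<^sub>R x" using False True by simp
    moreover have "0 < r" "r < 1" using True by (auto simp: r_def)
    ultimately have "x \<in> open_segment (c *\<^sub>R x) (2 *\<^sub>R x)"
      unfolding in_segment by blast
    then show ?thesis using face in\<sigma> c by simp
  next
    case c1: False
    have "x = (1 - 1 / c) *\<^sub>R 0 + (1 / c) *\<^sub>R (c *\<^sub>R x)"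
      using False c1 by simp
    moreover have "0 \<noteq> c *\<^sub>R x" using False c1 by simp
    moreover have "0 < 1 / c" "1 / c < 1" using False c1 by auto
    ultimately have "x \<in> open_segment 0 (c *\<^sub>R x)"
      unfolding in_segment by blast
    then show ?thesis using face(2)[of 0 "c *\<^sub>R x"] in\<sigma>[of 0] in\<sigma>[of c] c by simp
  qed
qed

text \<open>If 0 were a relative interior point, the ray would contain some nonzero vector together
  with its negative, against strong convexity. With \<open>e\<close> nonzero, dimension 1 confines
  the ray to the line through \<open>e\<close>, and strong convexity excludes the negative
  half.\<close>

lemma ray_eq_multiples:
  assumes \<sigma>: "convex_cone \<sigma>" "strongly_convex \<sigma>" and \<rho>: "\<rho> \<in> cone_rays \<sigma>"
    and e: "e \<in> rel_interior \<rho>"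
  shows "e \<noteq> 0" and "\<rho> = {c *\<^sub>R e | c. 0 \<le> c}"
proof -
  have face: "\<rho> face_of \<sigma>" and dim: "dim \<rho> = 1" using \<rho> by (auto simp: cone_rays_def)
  have sub: "\<rho> \<subseteq> \<sigma>" using face by (rule face_of_imp_subset)
  have e\<rho>: "e \<in> \<rho>" using e rel_interior_subset by blast
  have neg: "x = 0" if "x \<in> \<rho>" "- x \<in> \<rho>" for x
    using that sub \<sigma>(2) by (auto simp: strongly_convex_def)
  show e0: "e \<noteq> 0"
  proof
    assume "e = 0"
    then obtain r where r: "0 < r" "ball 0 r \<inter> affine hull \<rho> \<subseteq> \<rho>"
      using e by (auto simp: mem_rel_interior_ball)
    obtain x where x: "x \<in> \<rho>" "x \<noteq> 0"
      using dim by (metis dim_eq_0 subset_singletonD singletonD subsetI empty_iff zero_neq_one insertI1)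
    \<comment> \<open>Scales \<open>x\<close> to norm \<open>r / 2\<close>, inside the ball.\<close>
    define s where "s = r / (2 * norm x)"
    have s: "0 < s" using r x by (simp add: s_def)
    have "- (s *\<^sub>R x) = (1 + s) *\<^sub>R 0 + (- s) *\<^sub>R x" by simp
    also have "\<dots> \<in> affine hull \<rho>"
      using e\<rho> x \<open>e = 0\<close> by (intro mem_affine[OF affine_affine_hull]) (auto intro: hull_inc)
    finally have "- (s *\<^sub>R x) \<in> affine hull \<rho>" .
    moreover have "- (s *\<^sub>R x) \<in> ball 0 r" using r x by (simp add: s_def)
    ultimately have "- (s *\<^sub>R x) \<in> \<rho>" using r by blast
    moreover have "s *\<^sub>R x \<in> \<rho>"
      using face_of_convex_cone_scaleR[OF face \<sigma>(1) x(1)] s by simp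
    ultimately show False using neg[of "s *\<^sub>R x"] s x by simp
  qed
  have "\<rho> \<subseteq> span {e}"
  proof -
    have "dim {e} = 1" using e0 dim_eq_card_independent[of "{e}"] by simp
    then have "span {e} = span \<rho>"
      using e\<rho> dim by (intro dim_eq_span) auto
    then show ?thesis using span_superset by blast
  qed
  moreover have "0 \<le> c" if "c *\<^sub>R e \<in> \<rho>" for c
  proof (rule ccontr)
    assume c: "\<not> 0 \<le> c"
    have "(- inverse c) *\<^sub>R c *\<^sub>R e \<in> \<rho>"
      using that c by (intro face_of_convex_cone_scaleR[OF face \<sigma>(1) that]) auto
    then have "- e \<in> \<rho>" using c by simp
    then show False using neg[OF e\<rho>] e0 by simp
  qed
  moreover have "c *\<^sub>R e \<in> \<rho>" if "0 \<le> c" for c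
    using face_of_convex_cone_scaleR[OF face \<sigma>(1) e\<rho> that] .
  ultimately show "\<rho> = {c *\<^sub>R e | c. 0 \<le> c}"
    by (auto simp: span_singleton)
qed

section \<open>Cones of a simplicial fan, their rays and their faces\<close>

locale simplicial_fan =
  fixes \<Sigma> :: "'a::euclidean_space set set" and u :: "'a set \<Rightarrow> 'a"
  assumes fan: "fan \<Sigma> u" and simplicial: "simplicial \<Sigma> u"
begin

lemma cone_props:
  assumes "\<sigma> \<in> \<Sigma>"
  shows "polyhedral_cone \<sigma>" "strongly_convex \<sigma>" "convex_cone \<sigma>"
    "\<And>\<tau>. \<tau> face_of \<sigma> \<Longrightarrow> \<tau> \<noteq> {} \<Longrightarrow> \<tau> \<in> \<Sigma>"
proof -
  show poly: "polyhedral_cone \<sigma>" and "strongly_convex \<sigma>"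
    using fan assms by (auto simp: fan_def polyhedral_fan_def)
  show "convex_cone \<sigma>"
    using poly convex_cone_convex_cone_hull by (auto simp: polyhedral_cone_def)
  show "\<tau> \<in> \<Sigma>" if "\<tau> face_of \<sigma>" "\<tau> \<noteq> {}" for \<tau>
    using fan assms that unfolding fan_def polyhedral_fan_def by blast
qed

lemma ray_generator:
  assumes "\<sigma> \<in> \<Sigma>" "\<rho> \<in> cone_rays \<sigma>"
  shows "\<rho> = {c *\<^sub>R u \<rho> | c. 0 \<le> c}" "u \<rho> \<noteq> 0" "u \<rho> \<in> \<rho>" "\<rho> \<subseteq> \<sigma>"
proof -
  have \<rho>: "\<rho> face_of \<sigma>" "dim \<rho> = 1" using assms(2) by (auto simp: cone_rays_def)
  then have "\<rho> \<noteq> {}" by auto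
  then have "\<rho> \<in> \<Sigma>" by (rule cone_props(4)[OF assms(1) \<rho>(1)])
  then have ui: "u \<rho> \<in> rel_interior \<rho>"
    using \<rho>(2) fan by (simp add: fan_def cones_def)
  show "u \<rho> \<in> \<rho>" using ui rel_interior_subset by blast
  show "\<rho> \<subseteq> \<sigma>" by (rule face_of_imp_subset[OF \<rho>(1)])
  show "u \<rho> \<noteq> 0" "\<rho> = {c *\<^sub>R u \<rho> | c. 0 \<le> c}"
    by (rule ray_eq_multiples[OF cone_props(3,2)[OF assms(1)] assms(2) ui])+
qed

lemma independent_rays: "\<sigma> \<in> \<Sigma> \<Longrightarrow> independent (u ` cone_rays \<sigma>)"
  using simplicial by (simp add: simplicial_def)

lemma inj_on_rays:
  assumes "\<sigma> \<in> \<Sigma>"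
  shows "inj_on u (cone_rays \<sigma>)"
proof (rule inj_onI)
  fix \<rho> \<eta> assume *: "\<rho> \<in> cone_rays \<sigma>" "\<eta> \<in> cone_rays \<sigma>" "u \<rho> = u \<eta>"
  show "\<rho> = \<eta>"
    using ray_generator(1)[OF assms *(1)] ray_generator(1)[OF assms *(2), symmetric]
    unfolding *(3) by (rule trans)
qed

lemma finite_cone_rays: "\<sigma> \<in> \<Sigma> \<Longrightarrow> finite (cone_rays \<sigma>)"
  using independent_rays independent_bound inj_on_rays finite_imageD by blast

text \<open>A polyhedral cone comes with arbitrary generators. After discarding redundant ones, each
  spans a ray and is therefore a multiple of the chosen generator of that ray. This links the cone
  to the vectors whose independence \<open>simplicial\<close> asserts.\<close>

lemma cone_eq_hull_rays:
  assumes "\<sigma> \<in> \<Sigma>"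
  shows "\<sigma> = convex_cone hull (u ` cone_rays \<sigma>)"
proof
  show "convex_cone hull (u ` cone_rays \<sigma>) \<subseteq> \<sigma>"
    using ray_generator(3,4)[OF assms] cone_props(3)[OF assms] by (intro hull_minimal) blast+
  obtain S where S: "finite S" "\<sigma> = convex_cone hull S"
    using cone_props(1)[OF assms] by (auto simp: polyhedral_cone_def)
  obtain T where T: "T \<subseteq> S" "convex_cone hull T = \<sigma>"
    "\<And>v. v \<in> T \<Longrightarrow> v \<notin> convex_cone hull (T - {v})"
    using exists_irredundant_generators[OF S(1)] S(2) by metis
  have "t \<in> convex_cone hull (u ` cone_rays \<sigma>)" if t: "t \<in> T" for t
  proof -
    define R where "R = {c *\<^sub>R t | c. 0 \<le> c}"
    have R: "R \<in> cone_rays \<sigma>"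
      using irredundant_generator_ray[of T t] T S t cone_props(2)[OF assms] finite_subset[OF T(1) S(1)]
      by (simp add: R_def)
    have "t = 1 *\<^sub>R t" by simp
    then have "t \<in> R" unfolding R_def by (metis (mono_tags, lifting) mem_Collect_eq zero_le_one)
    then obtain c where "t = c *\<^sub>R u R" "0 \<le> c" using ray_generator(1)[OF assms R] by blast
    moreover have "u R \<in> convex_cone hull (u ` cone_rays \<sigma>)" using R by (intro hull_inc) simp
    ultimately show ?thesis by (metis convex_cone_hull_mul)
  qed
  then show "\<sigma> \<subseteq> convex_cone hull (u ` cone_rays \<sigma>)"
    unfolding T(2)[symmetric] by (intro hull_minimal) (auto simp: T(2) convex_cone_convex_cone_hull)
qed

lemma cone_eq_nonneg_span: "\<sigma> \<in> \<Sigma> \<Longrightarrow> \<sigma> = nonneg_span u (cone_rays \<sigma>)"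
  using cone_eq_hull_rays nonneg_span_eq_hull finite_cone_rays by metis

lemma coneE:
  assumes "\<sigma> \<in> \<Sigma>" "v \<in> \<sigma>"
  obtains a where "\<And>i. i \<in> cone_rays \<sigma> \<Longrightarrow> 0 \<le> a i" "v = (\<Sum>i\<in>cone_rays \<sigma>. a i *\<^sub>R u i)"
proof -
  have "v \<in> nonneg_span u (cone_rays \<sigma>)"
    using cone_eq_nonneg_span[OF assms(1)] assms(2) by blast
  then show ?thesis by (rule nonneg_spanE) (rule that)
qed

lemma span_rays:
  assumes "\<sigma> \<in> \<Sigma>"
  shows "span (u ` cone_rays \<sigma>) = span \<sigma>"
proof
  show "span (u ` cone_rays \<sigma>) \<subseteq> span \<sigma>"
    using ray_generator(3,4)[OF assms] by (intro span_mono) blast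
  show "span \<sigma> \<subseteq> span (u ` cone_rays \<sigma>)"
  proof (intro span_minimal subsetI)
    fix v assume v: "v \<in> \<sigma>"
    obtain a where "v = (\<Sum>i\<in>cone_rays \<sigma>. a i *\<^sub>R u i)"
      using assms v by (rule coneE) blast
    then show "v \<in> span (u ` cone_rays \<sigma>)"
      by (auto intro!: span_sum span_scale intro: span_base)
  qed simp
qed

lemma card_cone_rays:
  assumes "\<sigma> \<in> \<Sigma>"
  shows "card (cone_rays \<sigma>) = dim \<sigma>"
proof -
  have "dim \<sigma> = dim (u ` cone_rays \<sigma>)" by (metis assms span_rays dim_span)
  then show ?thesis
    using dim_eq_card_independent[OF independent_rays[OF assms]] inj_on_rays[OF assms]
    by (simp add: card_image)
qed

text \<open>Coefficients are unique by independence. If a point strictly between \<open>a\<close>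
  and \<open>b\<close> has zero coefficients outside \<open>J\<close>, nonnegativity forces the same
  for \<open>a\<close> and \<open>b\<close>.\<close>

lemma nonneg_span_face:
  assumes \<sigma>: "\<sigma> \<in> \<Sigma>" and J: "J \<subseteq> cone_rays \<sigma>"
  shows "nonneg_span u J face_of \<sigma>"
proof -
  let ?I = "cone_rays \<sigma>"
  note fin = finite_cone_rays[OF \<sigma>]
  have finJ: "finite J" using J fin by (rule finite_subset)
  have eq: "(\<Sum>i\<in>J. a i *\<^sub>R u i) = (\<Sum>i\<in>?I. (if i \<in> J then a i else 0) *\<^sub>R u i)" for a
    using J fin by (intro sum.mono_neutral_cong_left) auto
  show ?thesis
    unfolding face_of_def
  proof (intro conjI ballI impI)
    show "nonneg_span u J \<subseteq> \<sigma>"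
    proof
      fix v assume "v \<in> nonneg_span u J"
      then obtain a where "\<And>i. i \<in> J \<Longrightarrow> 0 \<le> a i" "v = (\<Sum>i\<in>J. a i *\<^sub>R u i)"
        by (rule nonneg_spanE) blast
      then have "v \<in> nonneg_span u ?I"
        using eq nonneg_spanI[of ?I "\<lambda>i. if i \<in> J then a i else 0" u] by auto
      then show "v \<in> \<sigma>"
        by (simp only: cone_eq_nonneg_span[OF \<sigma>, symmetric])
    qed
    show "convex (nonneg_span u J)"
      using nonneg_span_eq_hull[OF finJ, of u] convex_convex_cone_hull by metis
    fix a b x assume ab: "a \<in> \<sigma>" "b \<in> \<sigma>" and x: "x \<in> nonneg_span u J" "x \<in> open_segment a b"
    obtain c where c: "x = (\<Sum>i\<in>J. c i *\<^sub>R u i)" using x(1) by (rule nonneg_spanE) blast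
    obtain r where r: "0 < r" "r < 1" "x = (1 - r) *\<^sub>R a + r *\<^sub>R b"
      using x(2) by (auto simp: in_segment)
    obtain \<alpha> where \<alpha>: "\<And>v. v \<in> ?I \<Longrightarrow> 0 \<le> \<alpha> v" "a = (\<Sum>v\<in>?I. \<alpha> v *\<^sub>R u v)"
      using \<sigma> ab(1) by (rule coneE) blast
    obtain \<beta> where \<beta>: "\<And>v. v \<in> ?I \<Longrightarrow> 0 \<le> \<beta> v" "b = (\<Sum>v\<in>?I. \<beta> v *\<^sub>R u v)"
      using \<sigma> ab(2) by (rule coneE) blast
    have "(\<Sum>v\<in>?I. ((1 - r) * \<alpha> v + r * \<beta> v) *\<^sub>R u v) = x"
      unfolding r(3) \<alpha>(2) \<beta>(2)
      by (simp add: scaleR_sum_right scaleR_left_distrib sum.distrib)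
    then have x': "(\<Sum>v\<in>?I. ((1 - r) * \<alpha> v + r * \<beta> v) *\<^sub>R u v) =
        (\<Sum>i\<in>?I. (if i \<in> J then c i else 0) *\<^sub>R u i)"
      using c eq by simp
    have \<alpha>\<beta>: "\<alpha> v = 0 \<and> \<beta> v = 0" if "v \<in> ?I" "v \<notin> J" for v
    proof -
      have "(1 - r) * \<alpha> v + r * \<beta> v = 0"
        using sum_coeffs_unique[OF fin inj_on_rays[OF \<sigma>] independent_rays[OF \<sigma>] x' that(1)] that
        by simp
      moreover have "0 \<le> (1 - r) * \<alpha> v" "0 \<le> r * \<beta> v"
        using \<alpha>(1) \<beta>(1) that r by auto
      ultimately show ?thesis using r by (auto simp: add_nonneg_eq_0_iff)
    qed
    have "a = (\<Sum>i\<in>J. \<alpha> i *\<^sub>R u i)" "b = (\<Sum>i\<in>J. \<beta> i *\<^sub>R u i)"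
      unfolding \<alpha>(2) \<beta>(2) using J fin \<alpha>\<beta> by (intro sum.mono_neutral_right; auto)+
    then show "a \<in> nonneg_span u J" "b \<in> nonneg_span u J"
      using \<alpha>(1) \<beta>(1) J by (auto intro!: nonneg_spanI)
  qed
qed

lemma nonneg_span_in_fan:
  assumes "\<sigma> \<in> \<Sigma>" "J \<subseteq> cone_rays \<sigma>"
  shows "nonneg_span u J \<in> \<Sigma>"
  using cone_props(4)[OF assms(1) nonneg_span_face[OF assms]] nonneg_spanI[of J "\<lambda>_. 0" u] by auto

text \<open>A ray of the face is a ray of the whole cone by transitivity; uniqueness of coefficients
  then allows its generator to be a combination over \<open>J\<close> only if the ray belongs to
  \<open>J\<close>.\<close>

lemma cone_rays_nonneg_span:
  assumes \<sigma>: "\<sigma> \<in> \<Sigma>" and J: "J \<subseteq> cone_rays \<sigma>"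
  shows "cone_rays (nonneg_span u J) = J"
proof
  let ?I = "cone_rays \<sigma>" and ?F = "nonneg_span u J"
  note fin = finite_cone_rays[OF \<sigma>]
  have finJ: "finite J" using J fin by (rule finite_subset)
  have face: "?F face_of \<sigma>" by (rule nonneg_span_face[OF assms])
  show "J \<subseteq> cone_rays ?F"
  proof
    fix \<rho> assume \<rho>: "\<rho> \<in> J"
    then have I: "\<rho> \<in> ?I" using J by auto
    have "u \<rho> \<in> ?F" by (rule generator_in_nonneg_span[OF finJ \<rho>])
    have "\<rho> \<subseteq> ?F"
    proof
      fix v assume "v \<in> \<rho>"
      then obtain c where "v = c *\<^sub>R u \<rho>" "0 \<le> c" using ray_generator(1)[OF \<sigma> I] by blast
      with \<open>u \<rho> \<in> ?F\<close> show "v \<in> ?F"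
        using cone_props(3)[OF nonneg_span_in_fan[OF assms]] by (simp add: convex_cone_scaleR)
    qed
    moreover have "\<rho> face_of \<sigma>" using I by (simp add: cone_rays_def)
    ultimately have "\<rho> face_of ?F"
      using face_of_subset face_of_imp_subset[OF face] by blast
    then show "\<rho> \<in> cone_rays ?F" using I by (simp add: cone_rays_def)
  qed
  show "cone_rays ?F \<subseteq> J"
  proof
    fix \<rho> assume \<rho>: "\<rho> \<in> cone_rays ?F"
    then have \<rho>F: "\<rho> face_of ?F" "dim \<rho> = 1" by (simp_all add: cone_rays_def)
    then have I: "\<rho> \<in> ?I" using face_of_trans[OF \<rho>F(1) face] by (simp add: cone_rays_def)
    have "u \<rho> \<in> ?F"
      using ray_generator(3)[OF \<sigma> I] face_of_imp_subset[OF \<rho>F(1)] by blast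
    then obtain a where a: "u \<rho> = (\<Sum>i\<in>J. a i *\<^sub>R u i)" by (rule nonneg_spanE) blast
    show "\<rho> \<in> J"
    proof (rule ccontr)
      assume nJ: "\<rho> \<notin> J"
      have "(\<Sum>i\<in>?I. (if i = \<rho> then 1 else 0) *\<^sub>R u i) = u \<rho>"
        using I fin by (simp add: if_distrib[of "\<lambda>c. c *\<^sub>R _"] cong: if_cong)
      also note a
      also have "(\<Sum>i\<in>J. a i *\<^sub>R u i) = (\<Sum>i\<in>?I. (if i \<in> J then a i else 0) *\<^sub>R u i)"
        using J fin by (intro sum.mono_neutral_cong_left) auto
      finally have "(if \<rho> = \<rho> then 1 else 0) = (if \<rho> \<in> J then a \<rho> else 0)"
        using I by (rule sum_coeffs_unique[OF fin inj_on_rays[OF \<sigma>] independent_rays[OF \<sigma>]])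
      then show False using nJ by simp
    qed
  qed
qed

text \<open>The description in \<open>flag_face\<close> is satisfied by the nonnegative span of the
  listed rays, and by no other face, because every cone of the fan is the span of its rays.\<close>

lemma cone_rays_flag_face:
  assumes \<sigma>: "\<sigma> \<in> \<Sigma>" and J: "f ` {1..j} \<subseteq> cone_rays \<sigma>"
  shows "cone_rays (flag_face \<sigma> f j) = f ` {1..j}"
proof -
  let ?F = "nonneg_span u (f ` {1..j})"
  have "flag_face \<sigma> f j = ?F"
    unfolding flag_face_def
  proof (rule the_equality)
    show "?F face_of \<sigma> \<and> ?F \<noteq> {} \<and> cone_rays ?F = f ` {1..j}"
      using nonneg_span_face[OF assms] cone_rays_nonneg_span[OF assms]
        nonneg_spanI[of "f ` {1..j}" "\<lambda>_. 0" u] by auto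
  next
    fix \<tau> assume "\<tau> face_of \<sigma> \<and> \<tau> \<noteq> {} \<and> cone_rays \<tau> = f ` {1..j}"
    then have \<tau>: "\<tau> \<in> \<Sigma>" "cone_rays \<tau> = f ` {1..j}" using cone_props(4)[OF \<sigma>] by auto
    show "\<tau> = ?F"
      using cone_eq_nonneg_span[OF \<tau>(1)] unfolding \<tau>(2) .
  qed
  then show ?thesis using cone_rays_nonneg_span[OF assms] by simp
qed

end

section \<open>Dual lattices and Gram determinants\<close>

lemma int_span_superset: "S \<subseteq> int_span S"
proof
  fix s assume "s \<in> S"
  then show "s \<in> int_span S"
    unfolding int_span_def by (intro CollectI exI[of _ "{s}"] exI[of _ "\<lambda>_. 1"]) auto
qed

lemma int_span_subset_span: "int_span S \<subseteq> span S"
  unfolding int_span_def by (auto intro!: span_sum span_scale intro: span_base)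

lemma span_int_span: "span (int_span S) = span S"
  using span_mono[OF int_span_superset] span_minimal[OF int_span_subset_span subspace_span]
  by (rule subset_antisym[rotated])

lemma int_spanI:
  "finite J \<Longrightarrow> inj_on b J \<Longrightarrow> (\<Sum>i\<in>J. of_int (c i) *\<^sub>R b i) \<in> int_span (b ` J)"
  unfolding int_span_def
  by (intro CollectI exI[of _ "b ` J"] exI[of _ "\<lambda>v. c (inv_into J b v)"]) (auto simp: sum.reindex)

lemma int_spanE:
  assumes "v \<in> int_span (b ` J)" "finite J" "inj_on b J"
  obtains c :: "'i \<Rightarrow> int" where "v = (\<Sum>i\<in>J. of_int (c i) *\<^sub>R b i)"
proof -
  obtain T c where T: "T \<subseteq> b ` J" and v: "v = (\<Sum>w\<in>T. of_int (c w) *\<^sub>R w)"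
    using assms(1) by (auto simp: int_span_def)
  have "v = (\<Sum>w\<in>b ` J. of_int (if w \<in> T then c w else 0) *\<^sub>R w)"
    unfolding v using T assms(2) by (intro sum.mono_neutral_cong_left) auto
  also have "\<dots> = (\<Sum>i\<in>J. of_int (if b i \<in> T then c (b i) else 0) *\<^sub>R b i)"
    using assms(3) by (simp add: sum.reindex)
  finally show ?thesis by (rule that)
qed

locale gram_family =
  fixes ip :: "'a::euclidean_space \<Rightarrow> 'a \<Rightarrow> real" and u :: "'i \<Rightarrow> 'a" and I :: "'i set"
  assumes ip: "inner_product ip"
    and finite_I: "finite I" and inj_u: "inj_on u I" and independent_u: "independent (u ` I)"
begin

abbreviation G :: "'i \<Rightarrow> 'i \<Rightarrow> real" where
  "G i j \<equiv> ip (u i) (u j)"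

abbreviation L :: "'a set" where
  "L \<equiv> dual_lattice ip (int_span (u ` I))"

lemma ip_sym: "ip v w = ip w v"
  using ip unfolding inner_product_def by blast

lemma ip_pos: "v \<noteq> 0 \<Longrightarrow> 0 < ip v v"
  using ip unfolding inner_product_def by blast

lemma linear_ip_left: "linear (\<lambda>v. ip v w)" and linear_ip_right: "linear (ip w)"
  using ip by (simp_all add: inner_product_def bilinear_def)

lemma ip_sum_left: "ip (\<Sum>i\<in>J. a i *\<^sub>R b i) w = (\<Sum>i\<in>J. a i * ip (b i) w)"
  by (simp add: linear_sum[OF linear_ip_left] linear_scale[OF linear_ip_left])

lemma ip_sum_right: "ip w (\<Sum>i\<in>J. a i *\<^sub>R b i) = (\<Sum>i\<in>J. a i * ip w (b i))"
  by (simp add: linear_sum[OF linear_ip_right] linear_scale[OF linear_ip_right])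

lemma gram_times: "(\<Sum>j\<in>J. G i j * x j) = ip (\<Sum>j\<in>J. x j *\<^sub>R u j) (u i)"
  by (subst ip_sym) (simp add: ip_sum_right mult.commute)

lemma sum_u_unique:
  "(\<Sum>i\<in>I. a i *\<^sub>R u i) = (\<Sum>i\<in>I. b i *\<^sub>R u i) \<Longrightarrow> i \<in> I \<Longrightarrow> a i = b i"
  by (rule sum_coeffs_unique[OF finite_I inj_u independent_u])

lemma gram_positive:
  assumes J: "J \<subseteq> I" and nz: "\<exists>i\<in>J. x i \<noteq> 0"
  shows "0 < (\<Sum>i\<in>J. x i * (\<Sum>j\<in>J. G i j * x j))"
proof -
  let ?v = "\<Sum>j\<in>J. x j *\<^sub>R u j"
  have v: "?v = (\<Sum>j\<in>I. (if j \<in> J then x j else 0) *\<^sub>R u j)"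
    using J finite_I by (intro sum.mono_neutral_cong_left) auto
  have "?v \<noteq> 0"
  proof
    assume "?v = 0"
    then have "(\<Sum>j\<in>I. (if j \<in> J then x j else 0) *\<^sub>R u j) = (\<Sum>j\<in>I. 0 *\<^sub>R u j)"
      using v by simp
    moreover obtain i where "i \<in> J" "x i \<noteq> 0" using nz by blast
    ultimately show False using sum_u_unique[of "\<lambda>j. if j \<in> J then x j else 0" "\<lambda>_. 0" i] J by auto
  qed
  then have "0 < ip ?v ?v" by (rule ip_pos)
  also have "ip ?v ?v = (\<Sum>i\<in>J. x i * (\<Sum>j\<in>J. G i j * x j))"
    by (simp only: gram_times ip_sum_right)
  finally show ?thesis .
qed

lemma finite_index_subset:
  assumes "J \<subseteq> I"
  obtains g :: "'i \<Rightarrow> 'a basis_index" where "finite_index J g"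
proof (rule exists_finite_index)
  show "finite J" using assms finite_I by (rule finite_subset)
  have "card J \<le> card (u ` I)"
    using assms finite_I inj_u by (simp add: card_image card_mono)
  also have "\<dots> \<le> DIM('a)" using independent_bound[OF independent_u] by simp
  finally show "card J \<le> DIM('a)" .
qed (rule that)

lemma gram_det_on_pos:
  assumes "J \<subseteq> I"
  shows "0 < det_on J G"
proof -
  obtain g :: "'i \<Rightarrow> 'a basis_index" where "finite_index J g"
    using finite_index_subset[OF assms] .
  then show ?thesis by (rule finite_index.det_on_pos) (rule gram_positive[OF assms])
qed

lemma ip_zero_on_span:
  assumes "w \<in> span (u ` I)" "\<And>i. i \<in> I \<Longrightarrow> ip w (u i) = 0"
  shows "w = 0"
proof (rule ccontr)
  assume "w \<noteq> 0"
  moreover have "ip w w = 0"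
    using linear_eq_0_on_span[OF linear_ip_right, of "u ` I" w] assms by auto
  ultimately show False using ip_pos[of w] by simp
qed

text \<open>The coordinates of \<open>m i\<close> in the family \<open>u\<close> form column
  \<open>i\<close> of the inverse Gram matrix. In the expansion of \<open>v\<close>, the remainder
  is orthogonal to all generators and lies in their span, so it is 0.\<close>

lemma dual_basis:
  obtains m where "\<And>i. i \<in> I \<Longrightarrow> m i \<in> span (u ` I)"
    "\<And>i j. i \<in> I \<Longrightarrow> j \<in> I \<Longrightarrow> ip (m i) (u j) = (if i = j then 1 else 0)"
    "\<And>v. v \<in> span (u ` I) \<Longrightarrow> v = (\<Sum>i\<in>I. ip v (u i) *\<^sub>R m i)"
proof -
  obtain g :: "'i \<Rightarrow> 'a basis_index" where g: "finite_index I g"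
    using finite_index_subset[OF subset_refl] .
  have nz: "det_on I G \<noteq> 0" using gram_det_on_pos[OF subset_refl] by simp
  have "\<forall>i. \<exists>x. \<forall>j\<in>I. (\<Sum>l\<in>I. G j l * x l) = (if i = j then 1 else 0)"
  proof
    fix i
    obtain x where "\<And>j. j \<in> I \<Longrightarrow> (\<Sum>l\<in>I. G j l * x l) = (if i = j then 1 else 0)"
      by (rule finite_index.det_on_solve[OF g nz]) (rule that)
    then show "\<exists>x. \<forall>j\<in>I. (\<Sum>l\<in>I. G j l * x l) = (if i = j then 1 else 0)" by blast
  qed
  from choice[OF this] obtain x where
    x: "\<And>i j. j \<in> I \<Longrightarrow> (\<Sum>l\<in>I. G j l * x i l) = (if i = j then 1 else 0)"
    by blast
  define m where "m i = (\<Sum>l\<in>I. x i l *\<^sub>R u l)" for i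
  have 1: "m i \<in> span (u ` I)" for i
    unfolding m_def by (auto intro!: span_sum span_scale intro: span_base)
  have 2: "ip (m i) (u j) = (if i = j then 1 else 0)" if "j \<in> I" for i j
    using x[OF that] by (simp add: m_def gram_times)
  have 3: "v = (\<Sum>i\<in>I. ip v (u i) *\<^sub>R m i)" if v: "v \<in> span (u ` I)" for v
  proof -
    let ?w = "v - (\<Sum>i\<in>I. ip v (u i) *\<^sub>R m i)"
    have "?w \<in> span (u ` I)"
      using v 1 by (intro span_diff span_sum span_scale) auto
    moreover have "ip ?w (u j) = 0" if "j \<in> I" for j
    proof -
      have "ip ?w (u j) = ip v (u j) - (\<Sum>i\<in>I. ip v (u i) * ip (m i) (u j))"
        by (simp add: linear_diff[OF linear_ip_left] ip_sum_left)
      also have "(\<Sum>i\<in>I. ip v (u i) * ip (m i) (u j)) = (\<Sum>i\<in>I. if i = j then ip v (u i) else 0)"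
        using that by (intro sum.cong) (auto simp: 2)
      finally show ?thesis using that finite_I by simp
    qed
    ultimately have "?w = 0" by (rule ip_zero_on_span)
    then show ?thesis by simp
  qed
  show ?thesis using that[of m] 1 2 3 by blast
qed

lemma dual_lattice_iff: "v \<in> L \<longleftrightarrow> v \<in> span (u ` I) \<and> (\<forall>i\<in>I. ip v (u i) \<in> \<int>)"
proof -
  have "ip v n \<in> \<int>" if n: "n \<in> int_span (u ` I)" and v: "\<forall>i\<in>I. ip v (u i) \<in> \<int>" for n
  proof -
    obtain c :: "'i \<Rightarrow> int" where "n = (\<Sum>i\<in>I. of_int (c i) *\<^sub>R u i)"
      using int_spanE[OF n finite_I inj_u] .
    then show ?thesis using v by (auto simp: ip_sum_right intro!: Ints_sum Ints_mult)
  qed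
  then show ?thesis
    using int_span_superset[of "u ` I"] by (auto simp: dual_lattice_def span_int_span)
qed

lemma dual_basis_inj_independent:
  assumes m: "\<And>i j. i \<in> I \<Longrightarrow> j \<in> I \<Longrightarrow> ip (m i) (u j) = (if i = j then 1 else 0)"
  shows "inj_on m I" "independent (m ` I)"
proof -
  show inj: "inj_on m I"
  proof (rule inj_onI)
    fix i j assume "i \<in> I" "j \<in> I" "m i = m j"
    then show "i = j" using m[of i j] m[of j j] by (simp split: if_splits)
  qed
  show "independent (m ` I)"
  proof (rule independent_if_scalars_zero)
    fix f w assume 0: "(\<Sum>x\<in>m ` I. f x *\<^sub>R x) = 0" and "w \<in> m ` I"
    then obtain j where j: "j \<in> I" "w = m j" by auto
    have "0 = ip (\<Sum>i\<in>I. f (m i) *\<^sub>R m i) (u j)"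
      using 0 inj linear_0[OF linear_ip_left] by (simp add: sum.reindex)
    also have "\<dots> = (\<Sum>i\<in>I. if i = j then f (m i) else 0)"
      unfolding ip_sum_left using j m by (intro sum.cong) auto
    finally show "f w = 0" using j finite_I by simp
  qed (use finite_I in auto)
qed

text \<open>The basis dual to the ray generators serves: the coordinates of \<open>v\<close> in it
  are the pairings \<open>ip v (u i)\<close>, which are integers exactly on the lattice. Thus the
  choice in \<open>lattice_volume\<close> is not empty.\<close>

lemma exists_lattice_basis: "\<exists>B. lattice_basis B L"
proof -
  obtain m where m: "\<And>i. i \<in> I \<Longrightarrow> m i \<in> span (u ` I)"
    "\<And>i j. i \<in> I \<Longrightarrow> j \<in> I \<Longrightarrow> ip (m i) (u j) = (if i = j then 1 else 0)"
    "\<And>v. v \<in> span (u ` I) \<Longrightarrow> v = (\<Sum>i\<in>I. ip v (u i) *\<^sub>R m i)"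
    using dual_basis by blast
  note inj = dual_basis_inj_independent(1)[OF m(2)]
  have "int_span (m ` I) = L"
  proof
    show "int_span (m ` I) \<subseteq> L"
    proof
      fix v assume "v \<in> int_span (m ` I)"
      then obtain c :: "'i \<Rightarrow> int" where v: "v = (\<Sum>i\<in>I. of_int (c i) *\<^sub>R m i)"
        by (rule int_spanE[OF _ finite_I inj])
      have "v \<in> span (u ` I)"
        unfolding v using m(1) by (intro span_sum span_scale) auto
      moreover have "ip v (u j) \<in> \<int>" if "j \<in> I" for j
        unfolding v ip_sum_left using that m(2) by (intro Ints_sum Ints_mult) auto
      ultimately show "v \<in> L" by (simp add: dual_lattice_iff)
    qed
    show "L \<subseteq> int_span (m ` I)"
    proof
      fix v assume v: "v \<in> L"
      then have "\<forall>i\<in>I. \<exists>k :: int. ip v (u i) = of_int k"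
        unfolding dual_lattice_iff by (blast elim: Ints_cases)
      from bchoice[OF this] obtain c :: "'i \<Rightarrow> int"
        where c: "\<And>i. i \<in> I \<Longrightarrow> ip v (u i) = of_int (c i)" by blast
      have "v = (\<Sum>i\<in>I. ip v (u i) *\<^sub>R m i)"
        using v m(3) by (simp add: dual_lattice_iff)
      also have "\<dots> = (\<Sum>i\<in>I. of_int (c i) *\<^sub>R m i)"
        using c by (intro sum.cong) auto
      also have "\<dots> \<in> int_span (m ` I)"
        using finite_I inj by (rule int_spanI)
      finally show "v \<in> int_span (m ` I)" .
    qed
  qed
  then show ?thesis
    using dual_basis_inj_independent(2)[OF m(2)] finite_I
    by (intro exI[of _ "m ` I"]) (simp add: lattice_basis_def)
qed

text \<open>For a lattice basis \<open>\<beta>\<close> write \<open>u j = (\<Sum>i. H i j *\<^sub>R \<beta> i)\<close>.  Then \<open>G = K H\<close> with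
  \<open>K i l = ip (\<beta> l) (u i)\<close>, and \<open>K\<close> is unimodular because the dual basis inverts it over the
  integers.\<close>

lemma lattice_basis_change:
  assumes B: "lattice_basis B L"
  obtains \<beta> H where "bij_betw \<beta> I B" "span B = span (u ` I)"
    "\<And>j. j \<in> I \<Longrightarrow> u j = (\<Sum>i\<in>I. H i j *\<^sub>R \<beta> i)" "\<bar>det_on I H\<bar> = det_on I G"
proof -
  obtain m where m: "\<And>i. i \<in> I \<Longrightarrow> m i \<in> span (u ` I)"
    "\<And>i j. i \<in> I \<Longrightarrow> j \<in> I \<Longrightarrow> ip (m i) (u j) = (if i = j then 1 else 0)"
    "\<And>v. v \<in> span (u ` I) \<Longrightarrow> v = (\<Sum>i\<in>I. ip v (u i) *\<^sub>R m i)"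
    using dual_basis by blast
  have finB: "finite B" and indB: "independent B" and spanB: "int_span B = L"
    using B by (auto simp: lattice_basis_def)
  have BL: "B \<subseteq> L" using spanB int_span_superset by metis
  have mL: "m i \<in> L" if "i \<in> I" for i
    using m(1,2) that by (auto simp: dual_lattice_iff)
  have sp: "span B = span (u ` I)"
  proof
    show "span B \<subseteq> span (u ` I)"
      using BL by (intro span_minimal) (auto simp: dual_lattice_iff)
    have mB: "m i \<in> span B" if "i \<in> I" for i
      using mL[OF that] int_span_subset_span[of B] spanB by blast
    show "span (u ` I) \<subseteq> span B"
    proof
      fix v assume "v \<in> span (u ` I)"
      then have "v = (\<Sum>i\<in>I. ip v (u i) *\<^sub>R m i)" by (rule m(3))
      also have "\<dots> \<in> span B" using mB by (intro span_sum span_scale)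
      finally show "v \<in> span B" .
    qed
  qed
  have "card B = card I"
  proof -
    have "card B = dim (span B)" using indB by (simp add: dim_eq_card_independent)
    also have "\<dots> = card (u ` I)" unfolding sp using independent_u by (simp add: dim_eq_card_independent)
    finally show ?thesis using inj_u by (simp add: card_image)
  qed
  then obtain \<beta> where \<beta>: "bij_betw \<beta> I B"
    using finite_same_card_bij[OF finite_I finB] by auto
  have \<beta>B: "inj_on \<beta> I" "\<beta> ` I = B" using \<beta> by (auto simp: bij_betw_def)
  define H where "H i j = representation B (u j) (\<beta> i)" for i j
  define K where "K i l = ip (\<beta> l) (u i)" for i l
  have uH: "u j = (\<Sum>i\<in>I. H i j *\<^sub>R \<beta> i)" if "j \<in> I" for j
  proof -
    have "u j \<in> span B" unfolding sp using that by (auto intro: span_base)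
    then have "u j = (\<Sum>b\<in>B. representation B (u j) b *\<^sub>R b)"
      using sum_representation_eq[OF indB _ finB subset_refl] by simp
    also have "\<dots> = (\<Sum>i\<in>I. H i j *\<^sub>R \<beta> i)"
      unfolding H_def using sum.reindex_bij_betw[OF \<beta>, of "\<lambda>b. representation B (u j) b *\<^sub>R b"] by simp
    finally show ?thesis .
  qed
  obtain g :: "'i \<Rightarrow> 'a basis_index" where g: "finite_index I g"
    using finite_index_subset[OF subset_refl] .
  have det_cong: "det_on I A = det_on I A'" if "\<And>i j. i \<in> I \<Longrightarrow> j \<in> I \<Longrightarrow> A i j = A' i j"
    for A A' :: "'i \<Rightarrow> 'i \<Rightarrow> real"
    unfolding det_on_def using that
    by (intro sum.cong refl arg_cong2[where f = "(*)"] prod.cong) (auto simp: permutes_in_image)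
  have GKH: "det_on I G = det_on I K * det_on I H"
  proof -
    have "G i j = (\<Sum>l\<in>I. K i l * H l j)" if "i \<in> I" "j \<in> I" for i j
    proof -
      have "G i j = ip (u i) (\<Sum>l\<in>I. H l j *\<^sub>R \<beta> l)" using uH[OF that(2)] by simp
      then show ?thesis by (simp add: ip_sum_right K_def ip_sym[of "u i"] mult.commute)
    qed
    then have "det_on I G = det_on I (\<lambda>i j. \<Sum>l\<in>I. K i l * H l j)"
      by (rule det_cong)
    then show ?thesis
      by (simp add: finite_index.det_on_mult[OF g])
  qed
  have "\<exists>c :: 'i \<Rightarrow> int. m j = (\<Sum>i\<in>I. of_int (c i) *\<^sub>R \<beta> i)" if "j \<in> I" for j
    using mL[OF that] int_spanE[of "m j" \<beta> I] spanB \<beta>B finite_I by metis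
  then obtain c :: "'i \<Rightarrow> 'i \<Rightarrow> int" where
    c: "\<And>j. j \<in> I \<Longrightarrow> m j = (\<Sum>i\<in>I. of_int (c j i) *\<^sub>R \<beta> i)" by metis
  define Q where "Q i j = real_of_int (c j i)" for i j
  \<comment> \<open>Column \<open>j\<close> of \<open>Q\<close> holds the integer coordinates of
    \<open>m j\<close> in \<open>\<beta>\<close>, so \<open>K Q\<close> is the matrix of pairings of
    dual basis and generators, the identity.\<close>
  have "det_on I K * det_on I Q = 1"
  proof -
    have "(if i = j then 1 else 0) = (\<Sum>l\<in>I. K i l * Q l j)" if "i \<in> I" "j \<in> I" for i j
    proof -
      have "(if i = j then 1 else 0) = ip (m j) (u i)" using m(2) that by auto
      also have "\<dots> = (\<Sum>l\<in>I. K i l * Q l j)"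
        unfolding c[OF that(2)] by (simp add: ip_sum_left K_def Q_def mult.commute)
      finally show ?thesis .
    qed
    then have "det_on I (\<lambda>i j. if i = j then 1 else 0) = det_on I (\<lambda>i j. \<Sum>l\<in>I. K i l * Q l j)"
      by (rule det_cong)
    then show ?thesis
      by (simp add: finite_index.det_on_mult[OF g] finite_index.det_on_id[OF g])
  qed
  moreover have "det_on I K \<in> \<int>"
  proof (rule det_on_Ints)
    fix i j assume "i \<in> I" "j \<in> I"
    then have "\<beta> j \<in> L" using \<beta>B BL by auto
    then show "K i j \<in> \<int>" using \<open>i \<in> I\<close> by (simp add: K_def dual_lattice_iff)
  qed
  moreover have "det_on I Q \<in> \<int>"
    by (rule det_on_Ints) (simp add: Q_def)
  ultimately have "\<bar>det_on I K\<bar> = 1"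
  proof -
    assume KQ: "det_on I K * det_on I Q = 1" and "det_on I K \<in> \<int>" "det_on I Q \<in> \<int>"
    then obtain a b where ab: "det_on I K = of_int a" "det_on I Q = of_int b"
      by (auto elim!: Ints_cases)
    then have "a * b = 1" using KQ by (metis of_int_eq_1_iff of_int_mult)
    then have "\<bar>a\<bar> = 1" by (auto simp: zmult_eq_1_iff)
    then show ?thesis unfolding ab by simp
  qed
  then have "\<bar>det_on I H\<bar> = \<bar>det_on I G\<bar>" using GKH by (simp add: abs_mult)
  also have "\<dots> = det_on I G" using gram_det_on_pos[OF subset_refl] by simp
  finally show ?thesis using that[OF \<beta> sp uH] by blast
qed

end

section \<open>Volumes in coordinates\<close>

text \<open>Turns an image under coordinate extraction into a preimage under linear combination, for
  which measurability is immediate.\<close>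

lemma coord_volume_eq:
  assumes B: "finite B" "independent B" and A: "A \<subseteq> span B"
  shows "coord_volume B A =
    measure (coord_lborel B) {s \<in> space (coord_lborel B). (\<Sum>b\<in>B. s b *\<^sub>R b) \<in> A}"
proof -
  have "(\<lambda>v. restrict (representation B v) B) ` A =
      {s \<in> space (coord_lborel B). (\<Sum>b\<in>B. s b *\<^sub>R b) \<in> A}"
  proof
    show "(\<lambda>v. restrict (representation B v) B) ` A \<subseteq>
        {s \<in> space (coord_lborel B). (\<Sum>b\<in>B. s b *\<^sub>R b) \<in> A}"
    proof
      fix s assume "s \<in> (\<lambda>v. restrict (representation B v) B) ` A"
      then obtain v where v: "v \<in> A" "s = restrict (representation B v) B" by auto
      have "(\<Sum>b\<in>B. s b *\<^sub>R b) = (\<Sum>b\<in>B. representation B v b *\<^sub>R b)"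
        using v(2) by (intro sum.cong) auto
      also have "\<dots> = v"
        using v(1) A by (intro sum_representation_eq[OF B(2) _ B(1)]) auto
      finally show "s \<in> {s \<in> space (coord_lborel B). (\<Sum>b\<in>B. s b *\<^sub>R b) \<in> A}"
        using v by (simp add: space_PiM)
    qed
    show "{s \<in> space (coord_lborel B). (\<Sum>b\<in>B. s b *\<^sub>R b) \<in> A} \<subseteq>
        (\<lambda>v. restrict (representation B v) B) ` A"
    proof
      fix s assume s: "s \<in> {s \<in> space (coord_lborel B). (\<Sum>b\<in>B. s b *\<^sub>R b) \<in> A}"
      let ?v = "\<Sum>b\<in>B. s b *\<^sub>R b"
      have "(\<Sum>b\<in>B. representation B ?v b *\<^sub>R b) = ?v"
        using s A by (intro sum_representation_eq[OF B(2) _ B(1)]) auto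
      then have "representation B ?v b = s b" if "b \<in> B" for b
        using sum_coeffs_unique[of B "\<lambda>b. b" "representation B ?v" s b] B that by simp
      then have "s = restrict (representation B ?v) B"
        using s by (auto simp: space_PiM PiE_def extensional_def fun_eq_iff)
      then show "s \<in> (\<lambda>v. restrict (representation B v) B) ` A"
        using s by blast
    qed
  qed
  then show ?thesis by (simp add: coord_volume_def)
qed

text \<open>In coordinates this is the standard simplex. As the unit of
  \<open>lattice_volume\<close> it supplies the factor \<open>fact (card B)\<close>.\<close>

lemma coord_volume_simplex:
  assumes B: "finite B" "independent B"
  shows "coord_volume B (convex hull (insert 0 B)) = 1 / fact (card B)"
proof -
  have B0: "0 \<notin> B" using B dependent_zero by blast
  have hull: "convex hull (insert 0 B) =
      {y. \<exists>r. (\<forall>b\<in>B. 0 \<le> r b) \<and> sum r B \<le> 1 \<and> (\<Sum>b\<in>B. r b *\<^sub>R b) = y}"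
    by (rule Starlike.simplex[OF B(1) B0])
  have "convex hull (insert 0 B) \<subseteq> span B"
    unfolding hull by (auto intro!: span_sum span_scale intro: span_base)
  moreover have "{s \<in> space (coord_lborel B). (\<Sum>b\<in>B. s b *\<^sub>R b) \<in> convex hull (insert 0 B)} =
      {s. (\<forall>b\<in>B. 0 \<le> s b) \<and> sum s B \<le> 1} \<inter> space (coord_lborel B)"
  proof -
    have "(\<forall>b\<in>B. 0 \<le> s b) \<and> sum s B \<le> 1"
      if "\<forall>b\<in>B. 0 \<le> r b" "sum r B \<le> 1" "(\<Sum>b\<in>B. r b *\<^sub>R b) = (\<Sum>b\<in>B. s b *\<^sub>R b)" for r s
    proof -
      have "r b = s b" if "b \<in> B" for b
        using sum_coeffs_unique[of B "\<lambda>b. b" r s b] B that \<open>(\<Sum>b\<in>B. r b *\<^sub>R b) = _\<close> by simp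
      then show ?thesis using that by (auto cong: sum.cong)
    qed
    then show ?thesis unfolding hull by blast
  qed
  ultimately show ?thesis
    using coord_volume_eq[OF B] emeasure_std_simplex_aux[OF B(1), of 1] by (simp add: measure_def)
qed

lemma distr_coord_lborel_reindex:
  assumes \<beta>: "bij_betw \<beta> I B" and I: "finite I"
  shows "distr (coord_lborel I) (coord_lborel B) (\<lambda>s. \<lambda>b\<in>B. s (inv_into I \<beta> b)) = coord_lborel B"
proof (rule lborel_product.PiM_eqI)
  let ?T = "\<lambda>s. \<lambda>b\<in>B. s (inv_into I \<beta> b)"
  have inv: "inv_into I \<beta> b \<in> I" "\<beta> (inv_into I \<beta> b) = b" if "b \<in> B" for b
    using that \<beta> by (auto simp: bij_betw_def inv_into_into f_inv_into_f)
  have \<beta>I: "\<beta> i \<in> B" "inv_into I \<beta> (\<beta> i) = i" if "i \<in> I" for i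
    using that \<beta> by (auto simp: bij_betw_def)
  show "finite B" using bij_betw_finite[OF \<beta>] I by simp
  fix A :: "'b \<Rightarrow> real set" assume A: "\<And>b. b \<in> B \<Longrightarrow> A b \<in> sets lborel"
  have T: "?T \<in> measurable (coord_lborel I) (coord_lborel B)"
    using inv(1) by (intro measurable_restrict) auto
  have "?T -` Pi\<^sub>E B A \<inter> space (coord_lborel I) = Pi\<^sub>E I (\<lambda>i. A (\<beta> i))"
  proof -
    have "(\<forall>b\<in>B. s (inv_into I \<beta> b) \<in> A b) \<longleftrightarrow> (\<forall>i\<in>I. s i \<in> A (\<beta> i))" for s
      using inv \<beta>I by metis
    then show ?thesis by (auto simp: space_PiM PiE_iff)
  qed
  then have "emeasure (distr (coord_lborel I) (coord_lborel B) ?T) (Pi\<^sub>E B A) =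
      (\<Prod>i\<in>I. emeasure lborel (A (\<beta> i)))"
    using T A I \<open>finite B\<close> \<beta>I
    by (subst emeasure_distr) (auto intro!: sets_PiM_I_finite lborel_product.emeasure_PiM)
  also have "\<dots> = (\<Prod>b\<in>B. emeasure lborel (A b))"
    by (rule prod.reindex_bij_betw[OF \<beta>])
  finally show "emeasure (distr (coord_lborel I) (coord_lborel B) ?T) (Pi\<^sub>E B A) =
      (\<Prod>b\<in>B. emeasure lborel (A b))" .
qed simp

lemma sets_coord_preimage:
  fixes b :: "'i \<Rightarrow> 'a::euclidean_space"
  assumes "finite I" "A \<in> sets borel"
  shows "{s \<in> space (coord_lborel I). (\<Sum>i\<in>I. s i *\<^sub>R b i) \<in> A} \<in> sets (coord_lborel I)"
proof -
  have "(\<lambda>s. \<Sum>i\<in>I. s i *\<^sub>R b i) \<in> borel_measurable (coord_lborel I)"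
    by measurable
  from measurable_sets[OF this assms(2)] show ?thesis
    by (simp add: vimage_def Int_def conj_commute)
qed

lemma measure_coord_reindex:
  fixes \<beta> :: "'i \<Rightarrow> 'a::euclidean_space"
  assumes \<beta>: "bij_betw \<beta> I B" and I: "finite I" and A: "A \<in> sets borel"
  shows "measure (coord_lborel B) {s \<in> space (coord_lborel B). (\<Sum>b\<in>B. s b *\<^sub>R b) \<in> A} =
    measure (coord_lborel I) {s \<in> space (coord_lborel I). (\<Sum>i\<in>I. s i *\<^sub>R \<beta> i) \<in> A}"
proof -
  let ?T = "\<lambda>s. \<lambda>b\<in>B. s (inv_into I \<beta> b)"
  let ?S = "{s \<in> space (coord_lborel B). (\<Sum>b\<in>B. s b *\<^sub>R b) \<in> A}"
  have inv: "inv_into I \<beta> b \<in> I" if "b \<in> B" for b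
    using that \<beta> by (auto simp: bij_betw_def inv_into_into)
  have finB: "finite B" using bij_betw_finite[OF \<beta>] I by simp
  have T: "?T \<in> measurable (coord_lborel I) (coord_lborel B)"
    using inv by (intro measurable_restrict) auto
  have "(\<Sum>b\<in>B. ?T s b *\<^sub>R b) = (\<Sum>i\<in>I. s i *\<^sub>R \<beta> i)" for s
  proof -
    have "(\<Sum>b\<in>B. ?T s b *\<^sub>R b) = (\<Sum>i\<in>I. ?T s (\<beta> i) *\<^sub>R \<beta> i)"
      by (rule sum.reindex_bij_betw[OF \<beta>, symmetric])
    also have "\<dots> = (\<Sum>i\<in>I. s i *\<^sub>R \<beta> i)"
      using \<beta> by (intro sum.cong) (auto simp: bij_betw_def)
    finally show ?thesis .
  qed
  then have "?T -` ?S \<inter> space (coord_lborel I) =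
      {s \<in> space (coord_lborel I). (\<Sum>i\<in>I. s i *\<^sub>R \<beta> i) \<in> A}"
    using measurable_space[OF T] by auto
  moreover have "measure (coord_lborel B) ?S =
      measure (distr (coord_lborel I) (coord_lborel B) ?T) ?S"
    by (simp only: distr_coord_lborel_reindex[OF \<beta> I])
  moreover have "\<dots> = measure (coord_lborel I) (?T -` ?S \<inter> space (coord_lborel I))"
    using T sets_coord_preimage[OF finB A, of "\<lambda>b. b"] by (rule measure_distr)
  ultimately show ?thesis by simp
qed

context gram_family
begin

text \<open>The matrix \<open>H\<close> converts coordinates in the ray generators into coordinates
  in the lattice basis, so volume scales by the absolute value of its determinant, which equals the
  Gram determinant.\<close>

lemma coord_volume_lattice_basis:
  assumes B: "lattice_basis B L" and A: "A \<in> sets borel" "A \<subseteq> span (u ` I)"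
    and fin: "emeasure (coord_lborel I) {x \<in> space (coord_lborel I). (\<Sum>i\<in>I. x i *\<^sub>R u i) \<in> A} < \<infinity>"
  shows "coord_volume B A = det_on I G *
    measure (coord_lborel I) {x \<in> space (coord_lborel I). (\<Sum>i\<in>I. x i *\<^sub>R u i) \<in> A}"
proof -
  obtain \<beta> H where \<beta>: "bij_betw \<beta> I B" and sp: "span B = span (u ` I)"
    and uH: "\<And>j. j \<in> I \<Longrightarrow> u j = (\<Sum>i\<in>I. H i j *\<^sub>R \<beta> i)" and H: "\<bar>det_on I H\<bar> = det_on I G"
    by (rule lattice_basis_change[OF B]) (rule that)
  have finB: "finite B" and indB: "independent B"
    using B by (auto simp: lattice_basis_def)
  have \<beta>B: "inj_on \<beta> I" "independent (\<beta> ` I)" using \<beta> indB by (auto simp: bij_betw_def)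
  let ?S = "{x \<in> space (coord_lborel I). (\<Sum>i\<in>I. x i *\<^sub>R u i) \<in> A}"
  let ?S' = "{s \<in> space (coord_lborel I). (\<Sum>i\<in>I. s i *\<^sub>R \<beta> i) \<in> A}"
  let ?h = "\<lambda>x. \<lambda>i\<in>I. \<Sum>j\<in>I. H i j * x j"
  have h: "(\<Sum>i\<in>I. ?h x i *\<^sub>R \<beta> i) = (\<Sum>j\<in>I. x j *\<^sub>R u j)" for x
  proof -
    have "(\<Sum>i\<in>I. ?h x i *\<^sub>R \<beta> i) = (\<Sum>i\<in>I. \<Sum>j\<in>I. (H i j * x j) *\<^sub>R \<beta> i)"
      by (simp add: scaleR_sum_left)
    also have "\<dots> = (\<Sum>j\<in>I. \<Sum>i\<in>I. (H i j * x j) *\<^sub>R \<beta> i)" by (rule sum.swap)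
    also have "\<dots> = (\<Sum>j\<in>I. x j *\<^sub>R u j)"
    proof (rule sum.cong)
      fix j assume "j \<in> I"
      then have "x j *\<^sub>R u j = x j *\<^sub>R (\<Sum>i\<in>I. H i j *\<^sub>R \<beta> i)" using uH by metis
      then show "(\<Sum>i\<in>I. (H i j * x j) *\<^sub>R \<beta> i) = x j *\<^sub>R u j"
        by (simp add: scaleR_sum_right mult.commute)
    qed simp
    finally show ?thesis .
  qed
  have image: "?h ` ?S = ?S'"
  proof
    show "?h ` ?S \<subseteq> ?S'"
    proof
      fix s assume "s \<in> ?h ` ?S"
      then obtain x where x: "x \<in> ?S" "s = ?h x" by blast
      have "(\<Sum>i\<in>I. s i *\<^sub>R \<beta> i) \<in> A" unfolding x(2) h using x(1) by blast
      moreover have "s \<in> space (coord_lborel I)" by (simp add: x(2) space_PiM)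
      ultimately show "s \<in> ?S'" by blast
    qed
    show "?S' \<subseteq> ?h ` ?S"
    proof
      fix s assume s: "s \<in> ?S'"
      let ?v = "\<Sum>i\<in>I. s i *\<^sub>R \<beta> i"
      have vA: "?v \<in> A" using s by blast
      then have "?v \<in> span (u ` I)" using A by blast
      then obtain c where c: "?v = (\<Sum>w\<in>u ` I. c w *\<^sub>R w)"
        using span_finite[of "u ` I"] finite_I by auto
      define x where "x = (\<lambda>i\<in>I. c (u i))"
      have xv: "(\<Sum>i\<in>I. x i *\<^sub>R u i) = ?v"
        unfolding c x_def using inj_u by (simp add: sum.reindex)
      have xS: "x \<in> ?S" using vA unfolding xv[symmetric] by (simp add: x_def space_PiM)
      have eq: "(\<Sum>i\<in>I. ?h x i *\<^sub>R \<beta> i) = ?v" unfolding h xv ..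
      have "?h x i = s i" for i
      proof (cases "i \<in> I")
        case True
        then show ?thesis by (rule sum_coeffs_unique[OF finite_I \<beta>B eq])
      next
        case False
        then show ?thesis using s by (auto simp: space_PiM PiE_def extensional_def)
      qed
      then have "s = ?h x" by (simp add: fun_eq_iff)
      then show "s \<in> ?h ` ?S" using xS by (rule image_eqI)
    qed
  qed
  obtain g :: "'i \<Rightarrow> 'a basis_index" where g: "finite_index I g"
    using finite_index_subset[OF subset_refl] .
  have "coord_volume B A = measure (coord_lborel B) {s \<in> space (coord_lborel B). (\<Sum>b\<in>B. s b *\<^sub>R b) \<in> A}"
    using finB indB A(2) unfolding sp[symmetric] by (rule coord_volume_eq)
  also have "\<dots> = measure (coord_lborel I) (?h ` ?S)"
    unfolding image by (rule measure_coord_reindex[OF \<beta> finite_I A(1)])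
  also have "\<dots> = \<bar>det_on I H\<bar> * measure (coord_lborel I) ?S"
  proof (rule finite_index.measure_coord_lborel_linear_image[OF g _ fin])
    show "?S \<in> sets (coord_lborel I)" by (rule sets_coord_preimage[OF finite_I A(1)])
    show "?h ` ?S \<in> sets (coord_lborel I)"
      unfolding image by (rule sets_coord_preimage[OF finite_I A(1)])
  qed
  finally show ?thesis by (simp add: H)
qed

text \<open>Both the volume of \<open>A\<close> and that of the unit simplex are known for every
  lattice basis, so the basis picked by \<open>SOME\<close> does not matter.\<close>

lemma lattice_volume_eq:
  assumes A: "A \<in> sets borel" "A \<subseteq> span (u ` I)"
    and fin: "emeasure (coord_lborel I) {x \<in> space (coord_lborel I). (\<Sum>i\<in>I. x i *\<^sub>R u i) \<in> A} < \<infinity>"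
  shows "lattice_volume L A = det_on I G * fact (card I) *
    measure (coord_lborel I) {x \<in> space (coord_lborel I). (\<Sum>i\<in>I. x i *\<^sub>R u i) \<in> A}"
proof -
  define B where "B = (SOME B. lattice_basis B L)"
  have B: "lattice_basis B L" unfolding B_def using exists_lattice_basis by (rule someI_ex)
  obtain \<beta> where "bij_betw \<beta> I B" by (rule lattice_basis_change[OF B]) (rule that)
  then have "card B = card I" by (simp add: bij_betw_same_card)
  moreover have "coord_volume B (convex hull (insert 0 B)) = 1 / fact (card B)"
    using B by (intro coord_volume_simplex) (auto simp: lattice_basis_def)
  ultimately show ?thesis
    using coord_volume_lattice_basis[OF B A fin] by (simp add: lattice_volume_def B_def[symmetric])
qed

end

section \<open>Volumes of normal polytopes\<close>

context simplicial_fan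
begin

lemma gram_family_cone:
  assumes "inner_product ip" "\<sigma> \<in> \<Sigma>"
  shows "gram_family ip u (cone_rays \<sigma>)"
  using assms finite_cone_rays inj_on_rays independent_rays by (simp add: gram_family_def)

text \<open>For each \<open>J\<close> the span of its generators is itself a cone of the fan, so
  pseudo-cubicality yields a point there with the prescribed pairings. Its coordinates are
  nonnegative, and Cramer's rule shows that they are the quotients.\<close>

lemma pseudo_cubical_gram_cone:
  assumes ip: "inner_product ip" and \<sigma>: "\<sigma> \<in> \<Sigma>" and z: "z \<in> pseudo_cubical \<Sigma> u ip"
  shows "pseudo_cubical_gram (cone_rays \<sigma>) (gram ip u) z
    (\<lambda>J \<rho>. det_on J (gram_replace ip u z \<rho>) / det_on J (gram ip u))"
proof -
  let ?I = "cone_rays \<sigma>" and ?G = "gram ip u"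
  let ?c = "\<lambda>J \<rho>. det_on J (gram_replace ip u z \<rho>) / det_on J ?G"
  interpret gram_family ip u ?I by (rule gram_family_cone[OF ip \<sigma>])
  have gram: "?G = G" by (simp add: gram_def fun_eq_iff)
  have c: "\<exists>x. \<forall>i\<in>J. 0 \<le> x i \<and> (\<Sum>j\<in>J. ?G i j * x j) = z i \<and> ?c J i = x i" if J: "J \<subseteq> ?I" for J
  proof -
    have "nonneg_span u J \<inter> {v. \<forall>\<rho>\<in>cone_rays (nonneg_span u J). ip v (u \<rho>) = z \<rho>} \<noteq> {}"
      using z nonneg_span_in_fan[OF \<sigma> J] by (simp add: pseudo_cubical_def)
    then obtain v where v: "v \<in> nonneg_span u J" "\<forall>\<rho>\<in>J. ip v (u \<rho>) = z \<rho>"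
      unfolding cone_rays_nonneg_span[OF \<sigma> J] by blast
    obtain x where x: "\<And>i. i \<in> J \<Longrightarrow> 0 \<le> x i" "v = (\<Sum>i\<in>J. x i *\<^sub>R u i)"
      using v(1) by (rule nonneg_spanE) (rule that)
    have eq: "(\<Sum>j\<in>J. ?G i j * x j) = z i" if "i \<in> J" for i
      using v(2) that by (simp add: gram gram_times x(2)[symmetric])
    obtain g :: "'a set \<Rightarrow> 'a basis_index" where g: "finite_index J g"
      by (rule finite_index_subset[OF J]) (rule that)
    have "?c J i = x i" if i: "i \<in> J" for i
    proof -
      have "gram_replace ip u z i = (\<lambda>\<eta> \<zeta>. if \<zeta> = i then z \<eta> else ?G \<eta> \<zeta>)"
        by (simp add: gram_replace_def fun_eq_iff)
      then have "det_on J (gram_replace ip u z i) = x i * det_on J ?G"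
        using finite_index.det_on_cramer[OF g i eq] by simp
      moreover have "det_on J ?G > 0" unfolding gram by (rule gram_det_on_pos[OF J])
      ultimately show ?thesis by simp
    qed
    then show ?thesis using x(1) eq by blast
  qed
  show ?thesis
  proof
    show "finite ?I" by (rule finite_cone_rays[OF \<sigma>])
    show "?G i j = ?G j i" for i j by (simp add: gram ip_sym)
    show "0 < (\<Sum>i\<in>J. x i * (\<Sum>j\<in>J. ?G i j * x j))" if "J \<subseteq> ?I" "\<exists>i\<in>J. x i \<noteq> 0" for J x
      unfolding gram by (rule gram_positive[OF that])
    show "0 \<le> ?c J i" if J: "J \<subseteq> ?I" and i: "i \<in> J" for J i
      using c[OF J] i by auto
    show "(\<Sum>j\<in>J. ?G i j * ?c J j) = z i" if J: "J \<subseteq> ?I" and i: "i \<in> J" for J i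
    proof -
      obtain x where x: "\<forall>i\<in>J. 0 \<le> x i \<and> (\<Sum>j\<in>J. ?G i j * x j) = z i \<and> ?c J i = x i"
        using c[OF J] by blast
      then have "(\<Sum>j\<in>J. ?G i j * ?c J j) = (\<Sum>j\<in>J. ?G i j * x j)"
        by (intro sum.cong) auto
      then show ?thesis using x i by simp
    qed
  qed
qed

lemma normal_polytope_borel:
  assumes "inner_product ip" "\<sigma> \<in> \<Sigma>"
  shows "normal_polytope ip u z \<sigma> \<in> sets borel"
proof -
  interpret gram_family ip u "cone_rays \<sigma>" by (rule gram_family_cone[OF assms])
  have "closed \<sigma>"
    using closed_convex_cone_hull[of "u ` cone_rays \<sigma>"] finite_cone_rays[OF assms(2)]
      cone_eq_hull_rays[OF assms(2)] by simp
  moreover have "closed {v. \<forall>\<rho>\<in>cone_rays \<sigma>. ip v (u \<rho>) \<le> z \<rho>}"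
  proof -
    have "closed {v. ip v (u \<rho>) \<le> z \<rho>}" for \<rho>
      using linear_continuous_on[of "\<lambda>v. ip v (u \<rho>)" UNIV] linear_ip_left[of "u \<rho>"]
      by (intro closed_Collect_le continuous_on_const) (simp add: linear_conv_bounded_linear)
    then have "closed (\<Inter>\<rho>\<in>cone_rays \<sigma>. {v. ip v (u \<rho>) \<le> z \<rho>})" by blast
    moreover have "(\<Inter>\<rho>\<in>cone_rays \<sigma>. {v. ip v (u \<rho>) \<le> z \<rho>}) =
        {v. \<forall>\<rho>\<in>cone_rays \<sigma>. ip v (u \<rho>) \<le> z \<rho>}" by blast
    ultimately show ?thesis by simp
  qed
  ultimately show ?thesis
    unfolding normal_polytope_def by (intro borel_closed closed_Int)
qed

text \<open>In generator coordinates the polytope is \<open>trunc\<close> at \<open>s = 1\<close>,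
  of measure \<open>ordering_sum\<close> over a factorial; \<open>lattice_volume_eq\<close>
  contributes the Gram determinant and the factorial that cancels.\<close>

lemma cone_volume_normal_polytope:
  assumes ip: "inner_product ip" and \<sigma>: "\<sigma> \<in> \<Sigma>" and z: "z \<in> pseudo_cubical \<Sigma> u ip"
  shows "cone_volume ip u \<sigma> (normal_polytope ip u z \<sigma>) = det_on (cone_rays \<sigma>) (gram ip u) *
    ordering_sum (\<lambda>J \<rho>. det_on J (gram_replace ip u z \<rho>) / det_on J (gram ip u)) (cone_rays \<sigma>)"
proof -
  let ?I = "cone_rays \<sigma>"
  define c where "c = (\<lambda>J \<rho>. det_on J (gram_replace ip u z \<rho>) / det_on J (gram ip u))"
  interpret gram_family ip u ?I by (rule gram_family_cone[OF ip \<sigma>])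
  interpret P: pseudo_cubical_gram ?I "gram ip u" z c
    unfolding c_def by (rule pseudo_cubical_gram_cone[OF assms])
  have gram: "gram ip u = G" by (simp add: gram_def fun_eq_iff)
  let ?P = "normal_polytope ip u z \<sigma>"
  let ?S = "{x \<in> space (coord_lborel ?I). (\<Sum>i\<in>?I. x i *\<^sub>R u i) \<in> ?P}"
  have mem: "(\<Sum>i\<in>?I. x i *\<^sub>R u i) \<in> \<sigma> \<longleftrightarrow> (\<forall>i\<in>?I. 0 \<le> x i)" for x
  proof
    assume "(\<Sum>i\<in>?I. x i *\<^sub>R u i) \<in> \<sigma>"
    with \<sigma> obtain a where a: "\<And>i. i \<in> ?I \<Longrightarrow> 0 \<le> a i"
      "(\<Sum>i\<in>?I. x i *\<^sub>R u i) = (\<Sum>i\<in>?I. a i *\<^sub>R u i)"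
      by (rule coneE) (rule that)
    then show "\<forall>i\<in>?I. 0 \<le> x i" using sum_u_unique[OF a(2)] by simp
  next
    assume "\<forall>i\<in>?I. 0 \<le> x i"
    then have "(\<Sum>i\<in>?I. x i *\<^sub>R u i) \<in> nonneg_span u ?I" by (intro nonneg_spanI) auto
    then show "(\<Sum>i\<in>?I. x i *\<^sub>R u i) \<in> \<sigma>" using cone_eq_nonneg_span[OF \<sigma>] by blast
  qed
  have S: "?S = P.trunc ?I 1 \<inter> space (coord_lborel ?I)"
    unfolding P.trunc_def by (auto simp: normal_polytope_def mem gram gram_times)
  have em: "emeasure (coord_lborel ?I) ?S = ennreal (ordering_sum c ?I / fact (card ?I))"
    unfolding S P.emeasure_trunc[OF subset_refl zero_le_one] by simp
  then have "measure (coord_lborel ?I) ?S = ordering_sum c ?I / fact (card ?I)"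
    using P.ordering_sum_nonneg[OF subset_refl] by (simp add: measure_def)
  moreover have "?P \<subseteq> span (u ` ?I)"
    using span_rays[OF \<sigma>] span_superset by (auto simp: normal_polytope_def)
  ultimately have "lattice_volume L ?P = det_on ?I G * fact (card ?I) * (ordering_sum c ?I / fact (card ?I))"
    using lattice_volume_eq[OF normal_polytope_borel[OF ip \<sigma>]] em by simp
  then show ?thesis by (simp add: cone_volume_def gram c_def)
qed

end

theorem theorem4p2:
  fixes \<Sigma> :: "'a::euclidean_space set set"
    and u :: "'a set \<Rightarrow> 'a"
    and ip :: "'a \<Rightarrow> 'a \<Rightarrow> real"
    and z :: "'a set \<Rightarrow> real"
    and \<sigma> :: "'a set"
    and d k :: nat
  assumes "d_fan d \<Sigma> u"
    and "simplicial \<Sigma> u"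
    and "inner_product ip"
    and "z \<in> pseudo_cubical \<Sigma> u ip"
    and "\<sigma> \<in> cones \<Sigma> k"
  shows "cone_volume ip u \<sigma> (normal_polytope ip u z \<sigma>) =
    gram_det ip u \<sigma> *
    (\<Sum>f\<in>ray_orderings k \<sigma>. \<Prod>j=1..k.
       gram_replace_det ip u z (flag_face \<sigma> f j) (f j) / gram_det ip u (flag_face \<sigma> f j))"
proof -
  interpret simplicial_fan \<Sigma> u
    using assms(1,2) by unfold_locales (auto simp: d_fan_def)
  have \<sigma>: "\<sigma> \<in> \<Sigma>" and k: "card (cone_rays \<sigma>) = k"
    using assms(5) card_cone_rays by (auto simp: cones_def)
  have ord: "ray_orderings k \<sigma> = orderings (cone_rays \<sigma>)"
    by (simp add: ray_orderings_def orderings_def k)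
  have "f ` {1..j} \<subseteq> cone_rays \<sigma>" if "f \<in> ray_orderings k \<sigma>" "j \<in> {1..k}" for f j
    using that by (auto simp: ray_orderings_def bij_betw_def)
  then have "(\<Sum>f\<in>ray_orderings k \<sigma>. \<Prod>j=1..k.
       gram_replace_det ip u z (flag_face \<sigma> f j) (f j) / gram_det ip u (flag_face \<sigma> f j)) =
      ordering_sum (\<lambda>J \<rho>. det_on J (gram_replace ip u z \<rho>) / det_on J (gram ip u)) (cone_rays \<sigma>)"
    unfolding ordering_sum_def ord[symmetric] k
    by (intro sum.cong prod.cong refl)
      (simp add: gram_replace_det_def gram_det_def cone_rays_flag_face[OF \<sigma>])
  then show ?thesis
    using cone_volume_normal_polytope[OF assms(3) \<sigma> assms(4)] by (simp add: gram_det_def)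
qed

end
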